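(* Let $X=\{X_n:n\ge 0\}$ be a sequence of real-valued random variables on a probability space $(\Omega,\mathcal F,\mathbb P)$ with $X_0=0$ and $\mathbb E[X_n]=0$ for all $n\ge 1$. Assume that $X$ satisfies the following four conditions. (A1) There exist a slowly varying function $L$, a number $a\in(0,1]$ and a function $g:\mathbb N\to\mathbb R_+$ with $g(n)\sim n^aL(n)$ such that, for some constant $C>0$ and all integers $n_1<n_2$, $$\left|\mathbb E\left[\left(\frac{X_{n_2}-X_{n_1}}{g(n_2-n_1)}\right)^2\right]-1\right|\le \frac{C}{1+\log(n_2-n_1)}.$$ (A2) For every pair of integers $n,p\ge 1$, $\limsup_{a\to\infty}\mathbb E[(X_{a+n}-X_a)^{2p}]<\infty$. (A3) With $g$ as in (A1) and $G$ a standard Gaussian random variable, there exist constants $C,\lambda>0$ such that for all $\theta\ge 1$ and all integers $n_2>n_1$, $$W_\theta\left(\frac{X_{n_2}-X_{n_1}}{g(n_2-n_1)},G\right)\le C\,\alpha(\theta)\,\frac{\theta^\lambda}{1+\log(n_2-n_1)},$$ where $\alpha(1)=1$ and $\alpha(\theta)=(\theta-1)^{1/2}$ for $\theta>1$, and moreover $$d_{\mathrm K}\left(\frac{X_{n_2}-X_{n_1}}{g(n_2-n_1)},G\right)\le \frac{C}{1+\log(n_2-n_1)}.$$ (A4) There is a fixed $q>1$ such that for every $\alpha>0$ there exists a constant $C_{\alpha,q}$ such that for all integers $d,m\ge 1$, setting $n_i=[q^{(m+i)^{1+\alpha}}]$ for $1\le i\le 2d$ (where $[x]$ is the integer part of $x$)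 and $$\mathbf Y=\left(\frac{X_{n_2}-X_{n_1}}{g(n_2-n_1)},\frac{X_{n_4}-X_{n_3}}{g(n_4-n_3)},\dots,\frac{X_{n_{2d}}-X_{n_{2d-1}}}{g(n_{2d}-n_{2d-1})}\right),$$ one has $W_1(\mathbf Y,\mathbf G)\le \dfrac{d\,C_{\alpha,q}}{1+\log(n_2-n_1)}$, where $\mathbf G$ is a $d$-dimensional vector of i.i.d. standard Gaussian random variables. Then, almost surely, $$\limsup_{n\to\infty}\frac{X_n}{\sqrt{2g^2(n)\log\log n}}=1\qquad\text{and}\qquad \liminf_{n\to\infty}\frac{X_n}{\sqrt{2g^2(n)\log\log n}}=-1.$$
   Context: A function $L$ is slowly varying if $\lim_{x\to\infty}L(ax)/L(x)=1$ for every $a>0$. For sequences, $u_n\sim v_n$ means $u_n/v_n\to 1$. For random vectors $\mathbf Z,\mathbf Y$ in $\mathbb R^d$, the Kolmogorov distance is $d_{\mathrm K}(\mathbf Z,\mathbf Y)=\sup_Q|\mathbb P[\mathbf Z\in Q]-\mathbb P[\mathbf Y\in Q]|$, the supremum over all sets $Q=(-\infty,a_1]\times\dots\times(-\infty,a_d]$. For $\theta\ge 1$ and random vectors with finite $\theta$-th moments, the $\theta$-Wasserstein distance is $W_\theta(\mathbf Z,\mathbf Y)=\inf(\mathbb E\|\mathbf U-\mathbf V\|^\theta)^{1/\theta}$, the infimum over all couplings $(\mathbf U,\mathbf V)$ with $\mathbf U\overset{law}{=}\mathbf Z$, $\mathbf V\overset{law}{=}\mathbf Y$, with $\|\cdot\|$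 the Euclidean norm. *)

theory Defs
  imports "HOL-Probability.Probability"
begin

definition slowly_varying :: "(real \<Rightarrow> real) \<Rightarrow> bool" where
  "slowly_varying L \<longleftrightarrow> (\<forall>a>0. ((\<lambda>x. L (a * x) / L x) \<longlongrightarrow> 1) at_top)"

definition std_gaussian :: "real measure" where
  "std_gaussian = density lborel std_normal_density"

definition std_gaussian_vec :: "nat \<Rightarrow> (nat \<Rightarrow> real) measure" where
  "std_gaussian_vec d = PiM {..<d} (\<lambda>_. std_gaussian)"

definition eucl_dist :: "nat \<Rightarrow> (nat \<Rightarrow> real) \<Rightarrow> (nat \<Rightarrow> real) \<Rightarrow> real" where
  "eucl_dist d u v = sqrt (\<Sum>i<d. (u i - v i)^2)"

definition couplings :: "'a measure \<Rightarrow> 'a measure \<Rightarrow> ('a \<times> 'a) measure set" where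
  "couplings P Q = {\<mu>. prob_space \<mu> \<and> sets \<mu> = sets (P \<Otimes>\<^sub>M Q)
                        \<and> distr \<mu> P fst = P \<and> distr \<mu> Q snd = Q}"

definition wasserstein :: "real \<Rightarrow> ('a \<Rightarrow> 'a \<Rightarrow> real) \<Rightarrow> 'a measure \<Rightarrow> 'a measure \<Rightarrow> real" where
  "wasserstein \<theta> \<delta> P Q =
     enn2real (INF \<mu>\<in>couplings P Q. \<integral>\<^sup>+ z. ennreal (\<delta> (fst z) (snd z) powr \<theta>) \<partial>\<mu>) powr (1 / \<theta>)"

definition kolmogorov_dist :: "real measure \<Rightarrow> real measure \<Rightarrow> real" where
  "kolmogorov_dist P Q = (SUP t. \<bar>measure P {..t} - measure Q {..t}\<bar>)"

definition alpha_fun :: "real \<Rightarrow> real" where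
  "alpha_fun \<theta> = (if \<theta> = 1 then 1 else sqrt (\<theta> - 1))"

end

theory Submission
  imports Defs "HOL-Real_Asymp.Real_Asymp"
begin

text \<open>
  By (A1) the \<open>L\<^sup>2\<close>-distance of \<open>X n\<close> and \<open>X m\<close> is at most a constant times \<open>g (n - m)\<close> and
  \<open>\<parallel>X n\<parallel> \<sim> g n\<close>. The triangle inequality then makes \<open>g\<close> nearly subadditive, and together with
  its growth along powers of two this replaces the uniform convergence theorem for slowly varying
  functions (not available, since \<open>L\<close> need not be measurable).

  Upper bound: on the grid \<open>N k = \<lceil>exp (k powr \<beta>)\<rceil>\<close> with \<open>\<beta> < 1\<close> close to 1, a near-optimal
  coupling for \<open>W\<^sub>\<theta>\<close> and Markov's inequality turn the error \<open>1 / log (N k)\<close> into a summable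
  \<open>(1 / log (N k)) powr \<theta>\<close>; consecutive grid points are so close that moments and dyadic
  chaining control the fluctuations between them.

  Lower bound: applying (A4) with \<open>d = m\<close>, the \<open>W\<^sub>1\<close>-error of the block \<open>m + 1, \<dots>, 3 m\<close> is of
  order \<open>m powr (- \<alpha>)\<close>, while for independent Gaussians some coordinate of the block exceeds
  the threshold with probability tending to 1.
\<close>

subsection \<open>Regular growth of the normalising sequence\<close>

text \<open>Two errors compete in the upper bound. On the grid \<open>exp k\<close> the coupling
  error is summable, but between grid points the path moves on the scale \<open>g (N k)\<close>
  itself, and a moment bound at level \<open>llog (N k)\<close> gains only powers of
  \<open>log k\<close>. With \<beta> < 1 the relative gap is of order
  \<open>k powr (\<beta> - 1)\<close>; since \<open>g\<close> grows at least like a power, the path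
  then moves by a polynomially small fraction of \<open>g (N k)\<close>, and a high moment is
  summable. The price is a Gaussian tail of order \<open>k powr (- \<beta> * (1 + e)^2)\<close>,
  which keeps \<beta> close to 1.

  The lower bound has no independence and hence no second Borel-Cantelli lemma: (A4) speaks of
  finite blocks only. But the event that no late increment is large lies in the no-hit event of
  every later block, so it suffices that the probabilities of the latter tend to 0. The grid grows
  so fast that the value at the previous point is negligible, unless it is hugely negative; this is
  excluded by the upper bound for the negative process. Hence the process and its negative are
  treated by the same lemmas, which also yields the lower limit.\<close>

lemma dyadic_chain:
  fixes d :: "nat \<Rightarrow> nat \<Rightarrow> real" and x :: "nat \<Rightarrow> real"
  assumes refl: "\<And>n. d n n = 0"
    and tri: "\<And>i j k. d i k \<le> d i j + d j k"
    and x0: "\<And>i. x i \<ge> 0"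
    and step: "\<And>i l. i < N \<Longrightarrow> (l + 1) * 2 ^ i \<le> 2 ^ N \<Longrightarrow> d (s + l * 2 ^ i) (s + (l + 1) * 2 ^ i) \<le> x i"
    and j: "j < 2 ^ N"
  shows "d s (s + j) \<le> (\<Sum>i<N. x i)"
  using step j
proof (induction N arbitrary: s j)
  case 0
  then show ?case using refl by simp
next
  case (Suc N)
  show ?case
  proof (cases "j < 2 ^ N")
    case True
    have "d s (s + j) \<le> (\<Sum>i<N. x i)"
    proof (rule Suc.IH[OF _ True])
      fix i l assume "i < N" and le: "(l + 1) * 2 ^ i \<le> (2::nat) ^ N"
      moreover have "(l + 1) * 2 ^ i \<le> (2::nat) ^ Suc N"
        using le by simp
      ultimately show "d (s + l * 2 ^ i) (s + (l + 1) * 2 ^ i) \<le> x i"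
        using Suc.prems(1)[of i l] by simp
    qed
    then show ?thesis using x0[of N] by simp
  next
    case False
    \<comment> \<open>The top binary digit of \<open>j\<close> is 1: one step over the longest
      interval, then chaining from \<open>s + 2 ^ N\<close>. Intervals aligned at the new base are
      aligned at \<open>s\<close> too, since \<open>2 ^ i\<close> divides \<open>2 ^ N\<close>; this
      is why the induction generalises \<open>s\<close>.\<close>
    define j' where "j' = j - 2 ^ N"
    have j: "j = 2 ^ N + j'" "j' < 2 ^ N"
      using False Suc.prems(2) by (auto simp: j'_def)
    have "d (s + 2 ^ N) (s + 2 ^ N + j') \<le> (\<Sum>i<N. x i)"
    proof (rule Suc.IH[OF _ j(2)])
      fix i l assume i: "i < N" and le: "(l + 1) * 2 ^ i \<le> (2::nat) ^ N"
      have e: "2 ^ N = 2 ^ (N - i) * (2::nat) ^ i" using i by (simp flip: power_add)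
      have "(l + 2 ^ (N - i) + 1) * 2 ^ i \<le> (2::nat) ^ Suc N"
        using le e by (simp add: algebra_simps)
      from Suc.prems(1)[OF _ this] i
      show "d (s + 2 ^ N + l * 2 ^ i) (s + 2 ^ N + (l + 1) * 2 ^ i) \<le> x i"
        by (simp add: e algebra_simps)
    qed
    moreover have "d s (s + 2 ^ N) \<le> x N"
      using Suc.prems(1)[of N 0] by simp
    ultimately show ?thesis using tri[of s "s + 2 ^ N + j'" "s + 2 ^ N"] j(1)
      by (simp add: add.assoc)
  qed
qed

lemma ex_floor_log2:
  assumes "(n::nat) \<ge> 1" obtains k where "2 ^ k \<le> n" "n < 2 ^ Suc k"
  using ex_power_ivl1[of 2 n] assms by auto

text \<open>From some index on the ratio exceeds \<open>t\<close>, so \<open>u i / t ^ i\<close> no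
  longer decreases. The finitely many earlier terms lie between \<open>lo\<close> and
  \<open>hi\<close>, which costs the factor \<open>hi / lo\<close>.\<close>

lemma geometric_growth_bound:
  fixes u :: "nat \<Rightarrow> real"
  assumes pos: "\<And>i. u i > 0" and lim: "(\<lambda>i. u (Suc i) / u i) \<longlonglongrightarrow> r" and "0 < t" "t < r"
  obtains C where "C > 0" "\<And>i k. i \<le> k \<Longrightarrow> u i \<le> C * u k / t ^ (k - i)"
proof -
  define v where "v i = u i / t ^ i" for i
  have vpos: "v i > 0" for i using pos \<open>0 < t\<close> by (simp add: v_def)
  have "\<forall>\<^sub>F i in sequentially. u (Suc i) / u i > t"
    using order_tendstoD(1)[OF lim \<open>t < r\<close>] .
  then obtain i0 where i0: "\<And>i. i \<ge> i0 \<Longrightarrow> u (Suc i) / u i > t"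
    by (auto simp: eventually_sequentially)
  have mono: "v i \<le> v (Suc i)" if "i \<ge> i0" for i
    using i0[OF that] pos[of i] \<open>0 < t\<close> by (simp add: v_def field_simps)
  have mono': "v i \<le> v k" if "i0 \<le> i" "i \<le> k" for i k
    using that(2)
  proof (induction k rule: dec_induct)
    case (step k)
    then show ?case using mono[of k] that(1) by simp
  qed simp
  define hi where "hi = Max (v ` {..i0})"
  define lo where "lo = Min (v ` {..i0})"
  have hi: "v i \<le> hi" and lo: "lo \<le> v i" if "i \<le> i0" for i
    using that by (auto simp: hi_def lo_def)
  have lo0: "lo > 0" using vpos by (auto simp: lo_def)
  have lohi: "lo \<le> hi" using hi[of i0] lo[of i0] by simp
  have main: "v i \<le> hi / lo * v k" if "i \<le> k" for i k
  proof (cases "i \<ge> i0")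
    case True
    have "v i \<le> v k" using mono' True that by simp
    moreover have "1 \<le> hi / lo" using lo0 lohi by simp
    ultimately show ?thesis using vpos[of k] mult_right_mono[of 1 "hi/lo" "v k"] by linarith
  next
    case False
    have "lo \<le> v k"
    proof (cases "k \<le> i0")
      case False then show ?thesis using mono'[of i0 k] lo[of i0] by simp
    qed (use lo in simp)
    then have "hi / lo * lo \<le> hi / lo * v k" using lo0 lohi by (intro mult_left_mono) auto
    then show ?thesis using hi[of i] False lo0 by simp
  qed
  show ?thesis
  proof (rule that[of "hi / lo"])
    show "hi / lo > 0" using lo0 lohi by simp
    fix i k :: nat assume ik: "i \<le> k"
    have "t ^ k = t ^ (k - i) * t ^ i" using ik by (simp flip: power_add)
    then show "u i \<le> hi / lo * u k / t ^ (k - i)"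
      using main[OF ik] \<open>0 < t\<close> by (simp add: v_def field_simps)
  qed
qed

text \<open>What is left of (A1) once randomness is removed: \<open>d\<close> will be the
  L2-distance of two process values and \<open>r\<close> will be \<open>2 powr a\<close>, so that
  \<open>r > 1\<close> is where \<open>a > 0\<close> enters. The slowly varying function survives
  only through \<open>g_double\<close>.\<close>

locale growth_gauge =
  fixes g :: "nat \<Rightarrow> real" and d :: "nat \<Rightarrow> nat \<Rightarrow> real" and K r :: real
  assumes g_pos: "\<And>n. g n > 0"
    and d_refl: "\<And>n. d n n = 0" and d_sym: "\<And>i j. d i j = d j i"
    and d_tri: "\<And>i j k. d i k \<le> d i j + d j k"
    and d_le: "\<And>m n. m < n \<Longrightarrow> d m n \<le> K * g (n - m)"
    and d_asymp: "(\<lambda>n. d 0 n / g n) \<longlonglongrightarrow> 1"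
    and g_double: "(\<lambda>i. g (2 ^ Suc i) / g (2 ^ i)) \<longlonglongrightarrow> r" and r_gt: "r > 1"
    and K_pos: "K > 0"
begin

lemma d_near_g:
  assumes "e > 0" shows "\<forall>\<^sub>F n in sequentially. \<bar>d 0 n - g n\<bar> \<le> e * g n"
proof -
  have "\<forall>\<^sub>F n in sequentially. dist (d 0 n / g n) 1 < e"
    using d_asymp assms by (rule tendstoD)
  then show ?thesis
  proof eventually_elim
    case (elim n)
    have "\<bar>d 0 n - g n\<bar> = dist (d 0 n / g n) 1 * g n"
      using g_pos[of n] by (simp add: dist_real_def field_simps flip: abs_mult_pos)
    then show ?case using elim g_pos[of n] by (simp add: mult_right_mono)
  qed
qed

lemma d_multiple: "n \<ge> 1 \<Longrightarrow> d 0 (p * n) \<le> real p * (K * g n)"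
proof (induction p)
  case (Suc p)
  have "d 0 (Suc p * n) \<le> d 0 (p * n) + d (p * n) (Suc p * n)" by (rule d_tri)
  also have "d (p * n) (Suc p * n) \<le> K * g n"
    using d_le[of "p * n" "Suc p * n"] Suc.prems by simp
  finally show ?case using Suc by (simp add: algebra_simps)
qed (simp add: d_refl)

lemma dyadic_growth:
  obtains C t where "C > 0" "t > 1" "\<And>i k. i \<le> k \<Longrightarrow> g (2 ^ i) \<le> C * g (2 ^ k) / t ^ (k - i)"
proof -
  obtain t where t: "1 < t" "t < r" using dense[OF r_gt] by auto
  obtain C where "C > 0" "\<And>i k. i \<le> k \<Longrightarrow> g (2 ^ i) \<le> C * g (2 ^ k) / t ^ (k - i)"
    by (rule geometric_growth_bound[of "\<lambda>i. g (2 ^ i)" r t]) (use t g_pos g_double in auto)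
  with t that show ?thesis by blast
qed

text \<open>Chaining bounds \<open>d 0 n\<close> by the sum of \<open>K * g (2 ^ i)\<close> over
  \<open>i \<le> k\<close>. Growth along powers of two makes this sum geometric and dominated by its
  last term, and \<open>d 0 n\<close> is asymptotic to \<open>g n\<close>.\<close>

lemma g_le_dyadic:
  obtains C where "C > 0" "\<And>n k. n \<ge> 1 \<Longrightarrow> n < 2 ^ Suc k \<Longrightarrow> g n \<le> C * g (2 ^ k)"
proof -
  obtain C t where C: "C > 0" "t > 1" "\<And>i k. i \<le> k \<Longrightarrow> g (2 ^ i) \<le> C * g (2 ^ k) / t ^ (k - i)"
    by (rule dyadic_growth) blast
  obtain n0 where n0: "\<And>n. n \<ge> n0 \<Longrightarrow> \<bar>d 0 n - g n\<bar> \<le> 1/2 * g n"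
    using d_near_g[of "1/2"] by (auto simp: eventually_sequentially)
  define B where "B = Max (g ` {..n0})"
  have B: "g n \<le> B" if "n \<le> n0" for n using that by (auto simp: B_def)
  have B0: "B > 0" using B[of 0] g_pos[of 0] by simp
  define D where "D = C * K * (t / (t - 1))"
  have D: "d 0 n \<le> D * g (2 ^ k)" if "n < 2 ^ Suc k" for n k
  proof -
    have "d 0 (0 + n) \<le> (\<Sum>i<Suc k. K * g (2 ^ i))"
    proof (rule dyadic_chain[OF d_refl d_tri _ _ that])
      fix i l :: nat
      show "0 \<le> K * g (2 ^ i)" using K_pos g_pos[of "2^i"] by simp
      show "d (0 + l * 2 ^ i) (0 + (l + 1) * 2 ^ i) \<le> K * g (2 ^ i)"
        using d_le[of "l * 2 ^ i" "(l + 1) * 2 ^ i"] by simp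
    qed
    also have "\<dots> \<le> (\<Sum>i<Suc k. K * (C * g (2 ^ k) * (1 / t) ^ (k - i)))"
      using C K_pos by (intro sum_mono mult_left_mono) (auto simp: power_one_over divide_simps)
    also have "\<dots> = K * C * g (2 ^ k) * (\<Sum>i<Suc k. (1 / t) ^ (k - i))"
      by (simp only: sum_distrib_left mult_ac)
    also have "(\<Sum>i<Suc k. (1 / t) ^ (k - i)) = (\<Sum>i<Suc k. (1 / t) ^ i)"
      by (rule sum.reindex_bij_witness[of _ "\<lambda>i. k - i" "\<lambda>i. k - i"]) auto
    also have "\<dots> \<le> (\<Sum>i. (1 / t) ^ i)"
      using C by (intro sum_le_suminf summable_geometric) auto
    also have "\<dots> = t / (t - 1)" using C by (subst suminf_geometric) (auto simp: field_simps)
    finally show ?thesis using C K_pos g_pos[of "2^k"] by (simp add: D_def mult_ac)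
  qed
  \<comment> \<open>Keeps \<open>g (2 ^ k)\<close> away from 0 uniformly in \<open>k\<close>, so
    that the finitely many values with \<open>n < n0\<close>, all at most \<open>B\<close>, can be
    absorbed into the constant.\<close>
  have low: "g 1 / C \<le> g (2 ^ k)" for k
  proof -
    have "g 1 \<le> C * g (2 ^ k) / t ^ k" using C(3)[of 0 k] by simp
    also have "\<dots> \<le> C * g (2 ^ k) / 1" using C g_pos[of "2^k"]
      by (intro divide_left_mono) (auto simp: one_le_power)
    finally show ?thesis using C by (simp add: field_simps)
  qed
  have D0: "D > 0" using C K_pos by (auto simp: D_def)
  show ?thesis
  proof (rule that[of "2 * D + B * C / g 1"])
    show "2 * D + B * C / g 1 > 0" using D0 B0 C g_pos[of 1] by (intro add_pos_pos divide_pos_pos mult_pos_pos) auto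
    fix n k :: nat assume n: "n \<ge> 1" "n < 2 ^ Suc k"
    show "g n \<le> (2 * D + B * C / g 1) * g (2 ^ k)"
    proof (cases "n \<ge> n0")
      case True
      have "g n \<le> 2 * d 0 n" using n0[OF True] by linarith
      also have "\<dots> \<le> 2 * D * g (2 ^ k)" using D[OF n(2)] by simp
      also have "\<dots> \<le> (2 * D + B * C / g 1) * g (2 ^ k)"
        using B0 C g_pos by (intro mult_right_mono) (auto simp: less_imp_le)
      finally show ?thesis .
    next
      case False
      have "g n \<le> B" using B False by simp
      also have "\<dots> = B * C / g 1 * (g 1 / C)" using C g_pos[of 1] by simp
      also have "\<dots> \<le> B * C / g 1 * g (2 ^ k)"
        using B0 C g_pos[of 1] low by (intro mult_left_mono) auto
      also have "\<dots> \<le> (2 * D + B * C / g 1) * g (2 ^ k)"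
        using D0 g_pos by (intro mult_right_mono) (auto simp: less_imp_le)
      finally show ?thesis .
    qed
  qed
qed

text \<open>A multiple of \<open>n\<close> lies within \<open>n\<close> of a much larger power of two, and the remaining gap is
  negligible by the growth of \<open>g\<close> along powers of two.\<close>
lemma g_ge_dyadic:
  obtains c where "c > 0" "\<And>n k. 2 ^ k \<le> n \<Longrightarrow> n < 2 ^ Suc k \<Longrightarrow> c * g (2 ^ k) \<le> g n"
proof -
  obtain C t where C: "C > 0" "t > 1" "\<And>i k. i \<le> k \<Longrightarrow> g (2 ^ i) \<le> C * g (2 ^ k) / t ^ (k - i)"
    by (rule dyadic_growth) blast
  obtain D where D: "D > 0" "\<And>n k. n \<ge> 1 \<Longrightarrow> n < 2 ^ Suc k \<Longrightarrow> g n \<le> D * g (2 ^ k)"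
    by (rule g_le_dyadic) blast
  obtain n0 where n0: "\<And>n. n \<ge> n0 \<Longrightarrow> \<bar>d 0 n - g n\<bar> \<le> 1/2 * g n"
    using d_near_g[of "1/2"] by (auto simp: eventually_sequentially)
  \<comment> \<open>The distance over the remainder \<open>s\<close> is at most
    \<open>K * D * C / t ^ l\<close> times \<open>g (2 ^ (k + l))\<close>. Once this fraction is
    below 1/4, the estimate \<open>g \<le> 2 * d 0\<close> at \<open>2 ^ (k + l)\<close> leaves half
    of \<open>g (2 ^ (k + l))\<close> to absorb on the left; what remains determines
    \<open>c1\<close>.\<close>
  obtain l where l: "t ^ l > 4 * K * D * C" using real_arch_pow[OF C(2)] by blast
  define c1 where "c1 = 1 / (4 * C * 2 ^ l * K)"
  have c1: "c1 > 0" using C K_pos by (simp add: c1_def)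
  have big: "c1 * g (2 ^ k) \<le> g n" if "2 ^ k \<le> n" "n < 2 ^ Suc k" "k \<ge> n0" for n k
  proof -
    define p where "p = 2 ^ (k + l) div n"
    define s where "s = (2::nat) ^ (k + l) mod n"
    have n1: "n \<ge> 1" using that(1) order_trans[OF one_le_power[of "2::nat" k]] by simp
    have split: "2 ^ (k + l) = p * n + s" by (simp add: p_def s_def)
    have s: "s < n" using n1 by (simp add: s_def)
    have p: "p \<le> 2 ^ l"
    proof -
      have "p * 2 ^ k \<le> p * n" using that(1) by simp
      also have "\<dots> \<le> 2 ^ l * 2 ^ k" using split by (simp add: power_add mult.commute)
      finally show ?thesis by simp
    qed
    have "d 0 (2 ^ (k + l)) \<le> d 0 (p * n) + d (p * n) (2 ^ (k + l))" by (rule d_tri)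
    also have "d 0 (p * n) \<le> 2 ^ l * (K * g n)"
    proof -
      have "d 0 (p * n) \<le> real p * (K * g n)" by (rule d_multiple[OF n1])
      also have "\<dots> \<le> 2 ^ l * (K * g n)"
        using p K_pos g_pos[of n] of_nat_mono[OF p, where 'a=real] by (intro mult_right_mono) auto
      finally show ?thesis .
    qed
    also have "d (p * n) (2 ^ (k + l)) \<le> 1/4 * g (2 ^ (k + l))"
    proof (cases "s = 0")
      case True
      then show ?thesis using split d_refl g_pos[of "2^(k+l)"] by simp
    next
      case False
      have "d (p * n) (2 ^ (k + l)) \<le> K * g s" using d_le[of "p*n" "p*n+s"] False split by simp
      also have "\<dots> \<le> K * (D * g (2 ^ k))"
        using D(2)[of s k] False s that K_pos by (intro mult_left_mono) auto
      also have "\<dots> \<le> K * (D * (C * g (2 ^ (k + l)) / t ^ l))"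
        using C(3)[of k "k+l"] K_pos D by (intro mult_left_mono) auto
      also have "\<dots> = K * D * C / t ^ l * g (2 ^ (k + l))" by simp
      also have "\<dots> \<le> 1/4 * g (2 ^ (k + l))"
        using l g_pos[of "2^(k+l)"] C by (intro mult_right_mono) (auto simp: divide_simps)
      finally show ?thesis .
    qed
    finally have "d 0 (2 ^ (k + l)) \<le> 2 ^ l * (K * g n) + 1/4 * g (2 ^ (k + l))" by simp
    moreover have "g (2 ^ (k + l)) \<le> 2 * d 0 (2 ^ (k + l))"
    proof -
      have "n0 \<le> 2 ^ (k + l)" using that(3) less_exp[of "k + l"] by linarith
      then show ?thesis using n0[of "2^(k+l)"] by linarith
    qed
    ultimately have "g (2 ^ (k + l)) \<le> 4 * 2 ^ l * K * g n" by simp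
    moreover have "g (2 ^ k) \<le> C * g (2 ^ (k + l))"
    proof -
      have "C * g (2 ^ (k + l)) / t ^ l \<le> C * g (2 ^ (k + l)) / 1"
        using C g_pos[of "2^(k+l)"] by (intro divide_left_mono) (auto simp: one_le_power)
      then show ?thesis using C(3)[of k "k+l"] by simp
    qed
    ultimately have "g (2 ^ k) \<le> C * (4 * 2 ^ l * K * g n)"
      using C(1) by (meson mult_left_mono order_trans less_imp_le)
    then show ?thesis using C K_pos by (simp add: c1_def field_simps)
  qed
  define c2 where "c2 = Min ((\<lambda>(n,k). g n / g (2 ^ k)) ` ({..2 ^ Suc n0} \<times> {..n0}))"
  have c2: "c2 > 0" using g_pos by (auto simp: c2_def)
  have small: "c2 * g (2 ^ k) \<le> g n" if "2 ^ k \<le> n" "n < 2 ^ Suc k" "k < n0" for n k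
  proof -
    have "n \<le> 2 ^ Suc n0"
    proof -
      have "(2::nat) ^ Suc k \<le> 2 ^ Suc n0" using that(3) by (intro power_increasing) auto
      then show ?thesis using that(2) by linarith
    qed
    then have "c2 \<le> g n / g (2 ^ k)" using that(3)
      by (auto simp: c2_def intro!: Min_le image_eqI[of _ _ "(n,k)"])
    then show ?thesis using g_pos[of "2^k"] by (simp add: field_simps)
  qed
  show ?thesis
  proof (rule that[of "min c1 c2"])
    show "min c1 c2 > 0" using c1 c2 by simp
    fix n k :: nat assume n: "2 ^ k \<le> n" "n < 2 ^ Suc k"
    have "min c1 c2 * g (2 ^ k) \<le> c1 * g (2 ^ k)" "min c1 c2 * g (2 ^ k) \<le> c2 * g (2 ^ k)"
      using g_pos by (auto intro!: mult_right_mono simp: less_imp_le)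
    then show "min c1 c2 * g (2 ^ k) \<le> g n" using big[OF n] small[OF n] by force
  qed
qed

text \<open>Potter's inequality for ratios below 1. Both arguments are compared with the powers of
  two below them; \<open>2 ^ i \<le> m\<close> and \<open>n < 2 ^ Suc k\<close> give
  \<open>1 / 2 ^ (k - i) \<le> 2 * (m / n)\<close>, whence the factor \<open>2 powr b\<close>. The
  exponent \<open>b\<close> is the growth rate \<open>t\<close> in base 2.\<close>

lemma potter_bound:
  obtains C b where "C > 0" "b > 0"
    "\<And>m n. 1 \<le> m \<Longrightarrow> m \<le> n \<Longrightarrow> g m \<le> C * (real m / real n) powr b * g n"
proof -
  obtain C t where C: "C > 0" "t > 1" "\<And>i k. i \<le> k \<Longrightarrow> g (2 ^ i) \<le> C * g (2 ^ k) / t ^ (k - i)"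
    by (rule dyadic_growth) blast
  obtain D where D: "D > 0" "\<And>n k. n \<ge> 1 \<Longrightarrow> n < 2 ^ Suc k \<Longrightarrow> g n \<le> D * g (2 ^ k)"
    by (rule g_le_dyadic) blast
  obtain c where c: "c > 0" "\<And>n k. 2 ^ k \<le> n \<Longrightarrow> n < 2 ^ Suc k \<Longrightarrow> c * g (2 ^ k) \<le> g n"
    by (rule g_ge_dyadic) blast
  define b where "b = log 2 t"
  have b: "b > 0" using C by (simp add: b_def)
  have tb: "t = 2 powr b" using C by (simp add: b_def)
  show ?thesis
  proof (rule that[of "D * C / c * 2 powr b" b])
    show "D * C / c * 2 powr b > 0" using C D c by simp
    show "b > 0" by fact
    fix m n :: nat assume mn: "1 \<le> m" "m \<le> n"
    obtain i where i: "2 ^ i \<le> m" "m < 2 ^ Suc i" by (rule ex_floor_log2[OF mn(1)]) blast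
    obtain k where k: "2 ^ k \<le> n" "n < 2 ^ Suc k" by (rule ex_floor_log2[OF order_trans[OF mn]]) blast
    have ik: "i \<le> k"
    proof -
      have "(2::nat) ^ i < 2 ^ Suc k" using i k mn by linarith
      then have "i < Suc k" by (rule power_less_imp_less_exp[rotated]) simp
      then show ?thesis by simp
    qed
    have "1 / t ^ (k - i) \<le> (2 * (real m / real n)) powr b"
    proof -
      have "real n * 2 ^ i \<le> 2 ^ Suc k * real m"
      proof (intro mult_mono)
        show "real n \<le> 2 ^ Suc k" using k(2) by (metis less_imp_le of_nat_le_iff of_nat_numeral of_nat_power)
        show "2 ^ i \<le> real m" using i(1) by (metis of_nat_le_iff of_nat_numeral of_nat_power)
      qed auto
      moreover have "(2::real) ^ k = 2 ^ (k - i) * 2 ^ i" using ik by (simp flip: power_add)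
      ultimately have "1 / 2 ^ (k - i) \<le> 2 * (real m / real n)"
        using mn by (simp add: divide_simps mult_ac)
      then have "(1 / 2 ^ (k - i)) powr b \<le> (2 * (real m / real n)) powr b"
        using b by (intro powr_mono2) auto
      moreover have "(1 / 2 ^ (k - i)) powr b = 1 / t ^ (k - i)"
        by (simp add: tb powr_divide powr_powr mult.commute flip: powr_realpow)
      ultimately show ?thesis by simp
    qed
    also have "\<dots> = 2 powr b * (real m / real n) powr b" by (rule powr_mult)
    finally have t: "1 / t ^ (k - i) \<le> 2 powr b * (real m / real n) powr b" .
    have "g m \<le> D * g (2 ^ i)" using D mn i by simp
    also have "\<dots> \<le> D * (C * g (2 ^ k) / t ^ (k - i))"
      using C(3)[OF ik] D by (intro mult_left_mono) auto
    also have "\<dots> = D * C * (1 / t ^ (k - i)) * g (2 ^ k)" by simp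
    also have "\<dots> \<le> D * C * (1 / t ^ (k - i)) * (g n / c)"
      using c k C D by (intro mult_left_mono) (auto simp: field_simps)
    also have "\<dots> \<le> D * C * (2 powr b * (real m / real n) powr b) * (g n / c)"
      using t C D c g_pos[of n] by (intro mult_right_mono mult_left_mono) auto
    finally show "g m \<le> D * C / c * 2 powr b * (real m / real n) powr b * g n"
      by (simp add: mult_ac)
  qed
qed

text \<open>\<open>g m\<close> and \<open>g n\<close> are close to \<open>d 0 m\<close> and
  \<open>d 0 n\<close>, which differ by at most \<open>d m n \<le> K * g (n - m)\<close>. The Potter
  bound makes the latter a small multiple of \<open>g n\<close> when \<open>n - m\<close> is a small
  fraction of \<open>n\<close>.\<close>

lemma g_close:
  assumes "e > 0"
  obtains \<delta> where "\<delta> > 0"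
    "\<forall>\<^sub>F n in sequentially. \<forall>m\<le>n. real (n - m) \<le> \<delta> * real n \<longrightarrow> \<bar>g m - g n\<bar> \<le> e * g n"
proof -
  obtain C b where C: "C > 0" "b > 0"
    "\<And>m n. 1 \<le> m \<Longrightarrow> m \<le> n \<Longrightarrow> g m \<le> C * (real m / real n) powr b * g n"
    by (rule potter_bound) blast
  \<comment> \<open>The asymptotic error is \<open>h * g n\<close> at \<open>n\<close> and
    \<open>h * g m\<close>, at most \<open>h * C * g n\<close>, at \<open>m\<close>. Together they
    use up \<open>e / 2\<close>; the other half is for \<open>d m n\<close>.\<close>
  define h where "h = e / (2 * (C + 1))"
  have h: "h > 0" using assms C by (simp add: h_def)
  obtain n0 where n0: "\<And>n. n \<ge> n0 \<Longrightarrow> \<bar>d 0 n - g n\<bar> \<le> h * g n"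
    using d_near_g[OF h] by (auto simp: eventually_sequentially)
  \<comment> \<open>The bound 1/2 keeps \<open>m\<close> above half of \<open>n\<close>, hence
    beyond \<open>n0\<close>; the other term makes \<open>K * C * \<delta> powr b\<close> at most
    \<open>e / 2\<close>.\<close>
  define \<delta> where "\<delta> = min (1/2) ((e / (2 * K * C)) powr (1 / b))"
  have \<delta>: "\<delta> > 0" "\<delta> \<le> 1/2" "\<delta> powr b \<le> e / (2 * K * C)"
  proof -
    show "\<delta> > 0" using assms K_pos C by (auto simp: \<delta>_def)
    show "\<delta> \<le> 1/2" by (simp add: \<delta>_def)
    have "\<delta> powr b \<le> ((e / (2 * K * C)) powr (1 / b)) powr b"
      using \<open>\<delta> > 0\<close> C by (intro powr_mono2) (auto simp: \<delta>_def)
    also have "\<dots> = e / (2 * K * C)" using assms C K_pos by (simp add: powr_powr)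
    finally show "\<delta> powr b \<le> e / (2 * K * C)" .
  qed
  have "\<bar>g m - g n\<bar> \<le> e * g n"
    if n: "n \<ge> 2 * n0 + 2" "m \<le> n" "real (n - m) \<le> \<delta> * real n" for n m
  proof (cases "m = n")
    case False
    have "\<delta> * real n \<le> 1/2 * real n" using \<delta> by (intro mult_right_mono) auto
    then have "real n - real m \<le> real n / 2" using n(2,3) by linarith
    then have m: "m \<ge> n0 + 1" using n by linarith
    have "d 0 n \<le> d 0 m + d m n" "d 0 m \<le> d 0 n + d m n"
      using d_tri[of 0 n m] d_tri[of 0 m n] d_sym[of m n] by auto
    moreover have "d m n \<le> e / 2 * g n"
    proof -
      have "d m n \<le> K * g (n - m)" using d_le[of m n] False n by simp
      also have "\<dots> \<le> K * (C * (real (n - m) / real n) powr b * g n)"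
        using C(3)[of "n - m" n] K_pos False n by (intro mult_left_mono) auto
      also have "\<dots> \<le> K * (C * (e / (2 * K * C)) * g n)"
      proof -
        have "real (n - m) / real n \<le> \<delta>" using n by (simp add: divide_le_eq)
        then have "(real (n - m) / real n) powr b \<le> \<delta> powr b"
          using C by (intro powr_mono2) auto
        then show ?thesis using \<delta> K_pos C g_pos[of n]
          by (intro mult_left_mono mult_right_mono) auto
      qed
      also have "\<dots> = e / 2 * g n" using K_pos C by simp
      finally show ?thesis .
    qed
    moreover have "\<bar>d 0 n - g n\<bar> \<le> h * g n" "\<bar>d 0 m - g m\<bar> \<le> h * g m"
      using n0[of n] n0[of m] n m by auto
    moreover have "h * g m \<le> h * (C * g n)"
    proof -
      have "(real m / real n) powr b \<le> 1" using n C by (intro powr_le1) auto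
      then have "C * (real m / real n) powr b * g n \<le> C * 1 * g n"
        using C g_pos[of n] by (intro mult_right_mono mult_left_mono) auto
      then show ?thesis using C(3)[of m n] m n h by (intro mult_left_mono) auto
    qed
    ultimately have "\<bar>g m - g n\<bar> \<le> h * g n + h * (C * g n) + e / 2 * g n" by linarith
    also have "\<dots> = h * (C + 1) * g n + e / 2 * g n" by (simp add: algebra_simps)
    also have "h * (C + 1) = e / 2" using C by (simp add: h_def field_simps)
    finally show ?thesis by simp
  qed (use assms g_pos[of n] in simp)
  then have "\<forall>\<^sub>F n in sequentially. \<forall>m\<le>n. real (n - m) \<le> \<delta> * real n \<longrightarrow> \<bar>g m - g n\<bar> \<le> e * g n"
    unfolding eventually_sequentially by blast
  with \<delta>(1) show ?thesis by (rule that)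
qed

end

subsection \<open>Gaussian tails and couplings\<close>

lemma prob_space_std_gaussian: "prob_space std_gaussian"
  unfolding std_gaussian_def by (rule prob_space_normal_density) simp

lemma sets_std_gaussian [simp, measurable_cong]: "sets std_gaussian = sets borel"
  by (simp add: std_gaussian_def)

lemma space_std_gaussian [simp]: "space std_gaussian = UNIV"
  by (simp add: std_gaussian_def)

text \<open>Exponential tilting: where \<open>s * v > x\<close>, one has
  \<open>v^2 \<ge> x^2 + (v - s * x)^2\<close>, so the density is at most
  \<open>exp (- x^2 / 2)\<close> times the normal density centred at \<open>s * x\<close>, whose
  total mass is 1. The sign \<open>s\<close> treats both tails at once.\<close>

lemma std_gaussian_tail_le:
  fixes s x :: real
  assumes s: "\<bar>s\<bar> = 1" and x: "x \<ge> 0"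
  shows "measure std_gaussian {v. s * v > x} \<le> exp (- x\<^sup>2 / 2)"
proof -
  interpret G: prob_space std_gaussian by (rule prob_space_std_gaussian)
  have [measurable]: "{v. s * v > x} \<in> sets borel" by measurable
  have s2: "s * s = 1" using s by (metis abs_mult_self_eq mult_1)
  have pt: "std_normal_density v * indicator {v. s * v > x} v
      \<le> exp (- x\<^sup>2 / 2) * normal_density (s * x) 1 v" for v
  proof (cases "s * v > x")
    case True
    then have "x * x \<le> x * (s * v)" using x by (intro mult_left_mono) auto
    moreover have "(v - s * x)\<^sup>2 = v\<^sup>2 - 2 * (x * (s * v)) + (s * s) * x\<^sup>2"
      by (simp add: power2_eq_square algebra_simps)
    ultimately have "x\<^sup>2 + (v - s * x)\<^sup>2 \<le> v\<^sup>2" by (simp add: s2 power2_eq_square)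
    then have "exp (- v\<^sup>2 / 2) \<le> exp (- x\<^sup>2 / 2) * exp (- (v - s * x)\<^sup>2 / 2)"
      by (simp flip: exp_add)
    then show ?thesis using True by (simp add: normal_density_def divide_right_mono)
  qed simp
  have "emeasure std_gaussian {v. s * v > x}
      = (\<integral>\<^sup>+v. ennreal (std_normal_density v * indicator {v. s * v > x} v) \<partial>lborel)"
    unfolding std_gaussian_def
    by (subst emeasure_density) (auto intro!: nn_integral_cong simp: indicator_def)
  also have "\<dots> \<le> (\<integral>\<^sup>+v. ennreal (exp (- x\<^sup>2 / 2)) * ennreal (normal_density (s * x) 1 v) \<partial>lborel)"
    using pt by (intro nn_integral_mono) (auto simp flip: ennreal_mult intro!: ennreal_leI)
  also have "\<dots> = ennreal (exp (- x\<^sup>2 / 2)) * ennreal 1"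
    by (subst nn_integral_cmult) (auto simp: nn_integral_eq_integral)
  finally show ?thesis by (simp add: G.emeasure_eq_measure)
qed

text \<open>A unit interval \<open>I\<close> just beyond the threshold suffices, the density there
  being at least its value at distance \<open>x + 1\<close> from 0. The shift by 1 is harmless,
  since only the leading order of the exponent matters later.\<close>

lemma std_gaussian_tail_ge:
  fixes s x :: real
  assumes s: "\<bar>s\<bar> = 1" and x: "x \<ge> 0"
  shows "measure std_gaussian {v. s * v > x} \<ge> exp (- (x + 1)\<^sup>2 / 2) / 3"
proof -
  interpret G: prob_space std_gaussian by (rule prob_space_std_gaussian)
  have [measurable]: "{v. s * v > x} \<in> sets borel" by measurable
  have s': "s = 1 \<or> s = -1" using s by auto
  define I where "I = (if s = 1 then {x<..<x+1} else {-(x+1)<..<-x})"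
  have I: "emeasure lborel I = 1" "I \<in> sets borel" by (auto simp: I_def)
  have "sqrt (2 * pi) \<le> 3" using pi_less_4 by (intro real_le_lsqrt) auto
  have pt: "exp (- (x + 1)\<^sup>2 / 2) / 3 * indicator I v
      \<le> std_normal_density v * indicator {v. s * v > x} v" for v
  proof (cases "v \<in> I")
    case True
    then have *: "s * v > x" "\<bar>v\<bar> \<le> \<bar>x + 1\<bar>" using s' x by (auto simp: I_def split: if_splits)
    have "v\<^sup>2 \<le> (x + 1)\<^sup>2" using *(2) by (simp only: abs_le_square_iff)
    then have "exp (- (x + 1)\<^sup>2 / 2) \<le> exp (- v\<^sup>2 / 2)" by simp
    then have "exp (- (x + 1)\<^sup>2 / 2) / 3 \<le> exp (- v\<^sup>2 / 2) / sqrt (2 * pi)"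
      using \<open>sqrt (2 * pi) \<le> 3\<close> by (intro frac_le) auto
    then show ?thesis using True * by (simp add: std_normal_density_def)
  qed simp
  have "ennreal (exp (- (x + 1)\<^sup>2 / 2) / 3) * emeasure lborel I
      = (\<integral>\<^sup>+v. ennreal (exp (- (x + 1)\<^sup>2 / 2) / 3 * indicator I v) \<partial>lborel)"
    using I(2) by (subst nn_integral_cmult_indicator[symmetric])
      (auto intro!: nn_integral_cong simp: indicator_def)
  also have "\<dots> \<le> (\<integral>\<^sup>+v. ennreal (std_normal_density v * indicator {v. s * v > x} v) \<partial>lborel)"
    using pt by (intro nn_integral_mono ennreal_leI)
  also have "\<dots> = emeasure std_gaussian {v. s * v > x}"
    unfolding std_gaussian_def
    by (subst emeasure_density) (auto intro!: nn_integral_cong simp: indicator_def)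
  finally show ?thesis using I(1) by (simp add: G.emeasure_eq_measure)
qed

lemma std_gaussian_abs_moment: "(\<integral>\<^sup>+v. ennreal (\<bar>v\<bar> ^ p) \<partial>std_gaussian) < \<infinity>"
proof -
  have "(\<integral>\<^sup>+v. ennreal (\<bar>v\<bar> ^ p) \<partial>std_gaussian)
      = (\<integral>\<^sup>+v. ennreal (std_normal_density v * \<bar>v\<bar> ^ p) \<partial>lborel)"
    unfolding std_gaussian_def by (subst nn_integral_density) (auto simp: ennreal_mult)
  also have "\<dots> < \<infinity>"
    using integrable_std_normal_moment_abs[of p] by (simp add: integrable_iff_bounded abs_mult)
  finally show ?thesis .
qed

section \<open>Transfer of events and moments along couplings\<close>

lemma markov_measure_le:
  assumes "finite_measure N" and [measurable]: "f \<in> borel_measurable N"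
    and c: "c > 0" and B: "B \<ge> 0" and le: "(\<integral>\<^sup>+z. ennreal (f z) \<partial>N) \<le> ennreal B"
  shows "measure N {z \<in> space N. f z \<ge> c} \<le> B / c"
proof -
  interpret finite_measure N by fact
  have "emeasure N {z \<in> space N. f z \<ge> c} = (\<integral>\<^sup>+z. indicator {z \<in> space N. f z \<ge> c} z \<partial>N)"
    by simp
  also have "\<dots> \<le> (\<integral>\<^sup>+z. ennreal (1 / c) * ennreal (f z) \<partial>N)"
  proof (intro nn_integral_mono)
    fix z assume "z \<in> space N"
    have "1 \<le> ennreal (1 / c) * ennreal (f z)" if "f z \<ge> c"
      using that c by (simp flip: ennreal_mult')
    then show "indicator {z \<in> space N. f z \<ge> c} z \<le> ennreal (1 / c) * ennreal (f z)"
      by (auto simp: indicator_def)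
  qed
  also have "\<dots> = ennreal (1 / c) * (\<integral>\<^sup>+z. ennreal (f z) \<partial>N)" by (rule nn_integral_cmult) simp
  also have "\<dots> \<le> ennreal (1 / c) * ennreal B" using le by (intro mult_left_mono) auto
  also have "\<dots> = ennreal (B / c)" using c B by (simp flip: ennreal_mult)
  finally show ?thesis using c B by (simp add: emeasure_eq_measure)
qed

lemma wasserstein_nonneg: "0 \<le> wasserstein \<theta> \<delta> P Q"
  by (simp add: wasserstein_def)

text \<open>The independent coupling serves as the coupling of finite cost: its cost is controlled
  by the moments of the two marginals alone.\<close>

lemma pair_measure_in_couplings:
  assumes "prob_space P" "prob_space Q"
  shows "P \<Otimes>\<^sub>M Q \<in> couplings P Q"
proof -
  interpret P: prob_space P by fact
  interpret Q: prob_space Q by fact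
  interpret PQ: pair_prob_space P Q ..
  have "distr (P \<Otimes>\<^sub>M Q) Q snd = distr (distr (Q \<Otimes>\<^sub>M P) (P \<Otimes>\<^sub>M Q) (\<lambda>(x, y). (y, x))) Q snd"
    using PQ.distr_pair_swap by simp
  also have "\<dots> = distr (Q \<Otimes>\<^sub>M P) Q fst"
    by (subst distr_distr) (auto simp: comp_def case_prod_beta)
  also have "\<dots> = Q" by (rule P.distr_pair_fst)
  finally show ?thesis
    by (simp add: couplings_def PQ.prob_space_axioms Q.distr_pair_fst)
qed

text \<open>A coupling of finite cost is needed because \<open>enn2real \<infinity> = 0\<close>: without one the value of
  \<open>wasserstein\<close> would carry no information.\<close>
lemma wasserstein_coupling:
  assumes \<theta>: "\<theta> > 0" and fin: "\<mu>0 \<in> couplings P Q"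
      "(\<integral>\<^sup>+z. ennreal (\<delta> (fst z) (snd z) powr \<theta>) \<partial>\<mu>0) < \<infinity>"
    and W: "wasserstein \<theta> \<delta> P Q \<le> w" and w: "w < w'"
  obtains \<mu> where "\<mu> \<in> couplings P Q"
    "(\<integral>\<^sup>+z. ennreal (\<delta> (fst z) (snd z) powr \<theta>) \<partial>\<mu>) \<le> ennreal (w' powr \<theta>)"
proof -
  define J where "J = (INF \<mu>\<in>couplings P Q. \<integral>\<^sup>+z. ennreal (\<delta> (fst z) (snd z) powr \<theta>) \<partial>\<mu>)"
  have "J \<le> (\<integral>\<^sup>+z. ennreal (\<delta> (fst z) (snd z) powr \<theta>) \<partial>\<mu>0)"
    unfolding J_def by (rule INF_lower) fact
  then have J: "J < \<infinity>" using fin(2) by (rule le_less_trans)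
  have W': "enn2real J powr (1 / \<theta>) \<le> w" using W by (simp add: wasserstein_def J_def)
  then have w0: "0 \<le> w" by (rule order_trans[OF powr_ge_zero])
  have "enn2real J = (enn2real J powr (1 / \<theta>)) powr \<theta>" using \<theta> by (simp add: powr_powr)
  also have "\<dots> \<le> w powr \<theta>" using W' \<theta> by (intro powr_mono2) auto
  also have "\<dots> < w' powr \<theta>" using w w0 \<theta> by (intro powr_less_mono2) auto
  finally have "J < ennreal (w' powr \<theta>)" using J
    by (metis enn2real_nonneg ennreal_enn2real_if ennreal_lessI infinity_ennreal_def less_irrefl powr_gt_zero order_le_less_trans)
  \<comment> \<open>The infimum need not be attained; the strict inequality \<open>w < w'\<close> is
    what provides an actual coupling.\<close>
  then obtain \<mu> where "\<mu> \<in> couplings P Q"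
    "(\<integral>\<^sup>+z. ennreal (\<delta> (fst z) (snd z) powr \<theta>) \<partial>\<mu>) < ennreal (w' powr \<theta>)"
    unfolding J_def INF_less_iff by blast
  then show ?thesis by (intro that[of \<mu>]) auto
qed

lemma couplingsD:
  assumes "\<mu> \<in> couplings P Q"
  shows "prob_space \<mu>" "sets \<mu> = sets (P \<Otimes>\<^sub>M Q)" "space \<mu> = space P \<times> space Q"
    "distr \<mu> P fst = P" "distr \<mu> Q snd = Q" "fst \<in> measurable \<mu> P" "snd \<in> measurable \<mu> Q"
proof -
  show s: "sets \<mu> = sets (P \<Otimes>\<^sub>M Q)" using assms by (simp add: couplings_def)
  show "space \<mu> = space P \<times> space Q"
    using sets_eq_imp_space_eq[OF s] by (simp add: space_pair_measure)
  show "fst \<in> measurable \<mu> P" "snd \<in> measurable \<mu> Q"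
    unfolding measurable_cong_sets[OF s refl] by auto
qed (use assms in \<open>auto simp: couplings_def\<close>)

text \<open>The event \<open>D\<close> collects the pairs that lie far apart: \<open>A\<close> can
  occur in the first coordinate only if \<open>B\<close> occurs in the second or the coupling
  fails.\<close>

lemma coupling_measure_le:
  assumes c: "\<mu> \<in> couplings P Q" and A: "A \<in> sets P" and B: "B \<in> sets Q" and D: "D \<in> sets \<mu>"
    and sub: "\<And>u v. u \<in> A \<Longrightarrow> v \<in> space Q \<Longrightarrow> v \<notin> B \<Longrightarrow> (u, v) \<in> D"
  shows "measure P A \<le> measure Q B + measure \<mu> D"
proof -
  note d = couplingsD[OF c]
  interpret \<mu>: prob_space \<mu> by (rule d)
  have "measure P A = measure \<mu> (fst -` A \<inter> space \<mu>)"
    using measure_distr[OF d(6) A] d(4) by simp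
  also have "\<dots> \<le> measure \<mu> ((snd -` B \<inter> space \<mu>) \<union> D)"
  proof (rule \<mu>.finite_measure_mono)
    show "fst -` A \<inter> space \<mu> \<subseteq> (snd -` B \<inter> space \<mu>) \<union> D"
      unfolding d(3) using sub by (auto simp del: UnCI) blast
    show "(snd -` B \<inter> space \<mu>) \<union> D \<in> sets \<mu>"
      using measurable_sets[OF d(7) B] D by auto
  qed
  also have "\<dots> \<le> measure \<mu> (snd -` B \<inter> space \<mu>) + measure \<mu> D"
    using measurable_sets[OF d(7) B] D by (intro measure_Un_le) auto
  also have "measure \<mu> (snd -` B \<inter> space \<mu>) = measure Q B"
    using measure_distr[OF d(7) B] d(5) by simp
  finally show ?thesis .
qed

lemma coupling_nn_integral:
  assumes c: "\<mu> \<in> couplings P Q"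
  shows "f \<in> borel_measurable P \<Longrightarrow> (\<integral>\<^sup>+z. f (fst z) \<partial>\<mu>) = (\<integral>\<^sup>+u. f u \<partial>P)"
    and "h \<in> borel_measurable Q \<Longrightarrow> (\<integral>\<^sup>+z. h (snd z) \<partial>\<mu>) = (\<integral>\<^sup>+v. h v \<partial>Q)"
proof -
  note d = couplingsD[OF c]
  show "(\<integral>\<^sup>+z. f (fst z) \<partial>\<mu>) = (\<integral>\<^sup>+u. f u \<partial>P)" if "f \<in> borel_measurable P"
    using nn_integral_distr[OF d(6), of f] that d(4) by simp
  show "(\<integral>\<^sup>+z. h (snd z) \<partial>\<mu>) = (\<integral>\<^sup>+v. h v \<partial>Q)" if "h \<in> borel_measurable Q"
    using nn_integral_distr[OF d(7), of h] that d(5) by simp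
qed

lemma abs_add_power_le: "\<bar>x + y :: real\<bar> ^ p \<le> 2 ^ p * (\<bar>x\<bar> ^ p + \<bar>y\<bar> ^ p)"
proof -
  have "\<bar>x + y\<bar> ^ p \<le> (2 * max \<bar>x\<bar> \<bar>y\<bar>) ^ p" by (intro power_mono) auto
  also have "\<dots> = 2 ^ p * max \<bar>x\<bar> \<bar>y\<bar> ^ p" by (simp add: power_mult_distrib)
  also have "\<dots> \<le> 2 ^ p * (\<bar>x\<bar> ^ p + \<bar>y\<bar> ^ p)" by (intro mult_left_mono) (auto simp: max_def)
  finally show ?thesis .
qed

lemma nn_integral_abs_add_power_le:
  assumes [measurable]: "f \<in> borel_measurable N" "h \<in> borel_measurable N"
  shows "(\<integral>\<^sup>+z. ennreal (\<bar>f z + h z\<bar> ^ p) \<partial>N)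
    \<le> 2 ^ p * ((\<integral>\<^sup>+z. ennreal (\<bar>f z\<bar> ^ p) \<partial>N) + (\<integral>\<^sup>+z. ennreal (\<bar>h z\<bar> ^ p) \<partial>N))"
proof -
  have "(\<integral>\<^sup>+z. ennreal (\<bar>f z + h z\<bar> ^ p) \<partial>N)
      \<le> (\<integral>\<^sup>+z. 2 ^ p * (ennreal (\<bar>f z\<bar> ^ p) + ennreal (\<bar>h z\<bar> ^ p)) \<partial>N)"
  proof (intro nn_integral_mono)
    fix z
    have "ennreal (\<bar>f z + h z\<bar> ^ p) \<le> ennreal (2 ^ p * (\<bar>f z\<bar> ^ p + \<bar>h z\<bar> ^ p))"
      by (intro ennreal_leI abs_add_power_le)
    also have "\<dots> = 2 ^ p * (ennreal (\<bar>f z\<bar> ^ p) + ennreal (\<bar>h z\<bar> ^ p))"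
      by (simp add: ennreal_mult ennreal_plus flip: ennreal_power)
    finally show "ennreal (\<bar>f z + h z\<bar> ^ p) \<le> 2 ^ p * (ennreal (\<bar>f z\<bar> ^ p) + ennreal (\<bar>h z\<bar> ^ p))" .
  qed
  also have "\<dots> = 2 ^ p * ((\<integral>\<^sup>+z. ennreal (\<bar>f z\<bar> ^ p) \<partial>N) + (\<integral>\<^sup>+z. ennreal (\<bar>h z\<bar> ^ p) \<partial>N))"
    by (subst nn_integral_cmult) (auto simp: nn_integral_add)
  finally show ?thesis .
qed

lemma abs_powr_of_nat: "p \<ge> 1 \<Longrightarrow> \<bar>x::real\<bar> powr real p = \<bar>x\<bar> ^ p"
  by (cases "x = 0") (auto simp: powr_realpow zero_power)

lemma real_wasserstein_coupling:
  fixes P Q :: "real measure" and p :: nat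
  assumes "prob_space P" "prob_space Q" and [measurable_cong]: "sets P = sets borel" "sets Q = sets borel"
    and P: "(\<integral>\<^sup>+u. ennreal (\<bar>u\<bar> ^ p) \<partial>P) < \<infinity>" and Q: "(\<integral>\<^sup>+v. ennreal (\<bar>v\<bar> ^ p) \<partial>Q) < \<infinity>"
    and p: "p \<ge> 1" and W: "wasserstein (real p) (\<lambda>x y. \<bar>x - y\<bar>) P Q \<le> w" "w < w'"
  obtains \<mu> where "\<mu> \<in> couplings P Q"
    "(\<integral>\<^sup>+z. ennreal (\<bar>fst z - snd z\<bar> ^ p) \<partial>\<mu>) \<le> ennreal (w' ^ p)"
proof -
  have c: "P \<Otimes>\<^sub>M Q \<in> couplings P Q" by (rule pair_measure_in_couplings) fact+
  note d = couplingsD[OF c]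
  have [measurable]: "fst \<in> borel_measurable (P \<Otimes>\<^sub>M Q)" "snd \<in> borel_measurable (P \<Otimes>\<^sub>M Q)"
    by measurable
  have "(\<integral>\<^sup>+z. ennreal (\<bar>fst z + - snd z\<bar> ^ p) \<partial>(P \<Otimes>\<^sub>M Q))
      \<le> 2 ^ p * ((\<integral>\<^sup>+z. ennreal (\<bar>fst z\<bar> ^ p) \<partial>(P \<Otimes>\<^sub>M Q)) + (\<integral>\<^sup>+z. ennreal (\<bar>- snd z\<bar> ^ p) \<partial>(P \<Otimes>\<^sub>M Q)))"
    by (rule nn_integral_abs_add_power_le) measurable
  also have "\<dots> = 2 ^ p * ((\<integral>\<^sup>+u. ennreal (\<bar>u\<bar> ^ p) \<partial>P) + (\<integral>\<^sup>+v. ennreal (\<bar>v\<bar> ^ p) \<partial>Q))"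
    using coupling_nn_integral(1)[OF c, of "\<lambda>u. ennreal (\<bar>u\<bar> ^ p)"]
      coupling_nn_integral(2)[OF c, of "\<lambda>u. ennreal (\<bar>u\<bar> ^ p)"] by simp
  also have "\<dots> < \<infinity>" using P Q by (simp add: ennreal_mult_less_top power_less_top_ennreal)
  finally have fin: "(\<integral>\<^sup>+z. ennreal (\<bar>fst z - snd z\<bar> powr real p) \<partial>(P \<Otimes>\<^sub>M Q)) < \<infinity>"
    using p by (simp add: abs_powr_of_nat)
  obtain \<mu> where \<mu>: "\<mu> \<in> couplings P Q"
    "(\<integral>\<^sup>+z. ennreal (\<bar>fst z - snd z\<bar> powr real p) \<partial>\<mu>) \<le> ennreal (w' powr real p)"
    by (rule wasserstein_coupling[OF _ c fin W]) (use p in auto)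
  have "0 \<le> w" using W(1) by (rule order_trans[OF wasserstein_nonneg])
  then have "w' powr real p = w' ^ p" using W by (simp add: powr_realpow)
  then show ?thesis using \<mu> p by (intro that[of \<mu>]) (simp_all add: abs_powr_of_nat)
qed

text \<open>The threshold is split: either the second coordinate exceeds \<open>x\<close>, or the
  two coordinates differ by at least \<open>y\<close>, which Markov's inequality of order
  \<open>p\<close> controls. A small \<open>w / y\<close> thus enters with an arbitrarily high
  power.\<close>

lemma coupling_tail_le:
  fixes P Q :: "real measure"
  assumes c: "\<mu> \<in> couplings P Q" and [measurable_cong]: "sets P = sets borel" "sets Q = sets borel"
    and cost: "(\<integral>\<^sup>+z. ennreal (\<bar>fst z - snd z\<bar> ^ p) \<partial>\<mu>) \<le> ennreal (w ^ p)" and w: "w \<ge> 0"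
    and s: "\<bar>s\<bar> = 1" and y: "y > 0"
  shows "measure P {u. s * u > x + y} \<le> measure Q {v. s * v > x} + (w / y) ^ p"
proof -
  note d = couplingsD[OF c]
  interpret \<mu>: prob_space \<mu> by (rule d)
  have sp: "space P = UNIV" "space Q = UNIV" using sets_eq_imp_space_eq[OF assms(2)] sets_eq_imp_space_eq[OF assms(3)] by simp_all
  have [measurable]: "fst \<in> borel_measurable \<mu>" "snd \<in> borel_measurable \<mu>"
    using d(6,7) measurable_cong_sets[OF refl assms(2)] measurable_cong_sets[OF refl assms(3)] by auto
  have "measure P {u. s * u > x + y} \<le> measure Q {v. s * v > x}
      + measure \<mu> {z \<in> space \<mu>. \<bar>fst z - snd z\<bar> ^ p \<ge> y ^ p}"
  proof (rule coupling_measure_le[OF c])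
    show "{u. s * u > x + y} \<in> sets P" "{v. s * v > x} \<in> sets Q"
      unfolding assms(2,3) by measurable
    show "{z \<in> space \<mu>. \<bar>fst z - snd z\<bar> ^ p \<ge> y ^ p} \<in> sets \<mu>" by measurable
    fix u v assume "u \<in> {u. x + y < s * u}" "v \<notin> {v. x < s * v}"
    then have "y \<le> s * (u - v)" by (simp add: algebra_simps)
    also have "\<dots> \<le> \<bar>u - v\<bar>" using s by (metis abs_ge_self abs_mult mult_1)
    finally show "(u, v) \<in> {z \<in> space \<mu>. \<bar>fst z - snd z\<bar> ^ p \<ge> y ^ p}"
      using y sp d(3) by (auto intro!: power_mono)
  qed
  also have "measure \<mu> {z \<in> space \<mu>. \<bar>fst z - snd z\<bar> ^ p \<ge> y ^ p} \<le> w ^ p / y ^ p"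
    using y w cost by (intro markov_measure_le) (auto simp: \<mu>.finite_measure_axioms)
  finally show ?thesis by (simp add: power_divide)
qed

lemma coupling_moment_le:
  fixes P Q :: "real measure"
  assumes c: "\<mu> \<in> couplings P Q" and [measurable_cong]: "sets P = sets borel" "sets Q = sets borel"
    and cost: "(\<integral>\<^sup>+z. ennreal (\<bar>fst z - snd z\<bar> ^ p) \<partial>\<mu>) \<le> ennreal (w ^ p)"
  shows "(\<integral>\<^sup>+u. ennreal (\<bar>u\<bar> ^ p) \<partial>P) \<le> 2 ^ p * (ennreal (w ^ p) + (\<integral>\<^sup>+v. ennreal (\<bar>v\<bar> ^ p) \<partial>Q))"
proof -
  note d = couplingsD[OF c]
  have [measurable]: "fst \<in> borel_measurable \<mu>" "snd \<in> borel_measurable \<mu>"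
    using d(6,7) measurable_cong_sets[OF refl assms(2)] measurable_cong_sets[OF refl assms(3)] by auto
  have "(\<integral>\<^sup>+u. ennreal (\<bar>u\<bar> ^ p) \<partial>P) = (\<integral>\<^sup>+z. ennreal (\<bar>(fst z - snd z) + snd z\<bar> ^ p) \<partial>\<mu>)"
    using coupling_nn_integral(1)[OF c, of "\<lambda>u. ennreal (\<bar>u\<bar> ^ p)"] by simp
  also have "\<dots> \<le> 2 ^ p * ((\<integral>\<^sup>+z. ennreal (\<bar>fst z - snd z\<bar> ^ p) \<partial>\<mu>) + (\<integral>\<^sup>+z. ennreal (\<bar>snd z\<bar> ^ p) \<partial>\<mu>))"
    by (rule nn_integral_abs_add_power_le) measurable
  also have "(\<integral>\<^sup>+z. ennreal (\<bar>snd z\<bar> ^ p) \<partial>\<mu>) = (\<integral>\<^sup>+v. ennreal (\<bar>v\<bar> ^ p) \<partial>Q)"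
    using coupling_nn_integral(2)[OF c, of "\<lambda>u. ennreal (\<bar>u\<bar> ^ p)"] by simp
  finally show ?thesis using cost
    by (meson add_right_mono mult_left_mono order_trans zero_le)
qed

section \<open>Couplings with a Gaussian vector\<close>

lemma eucl_dist_ge_component: "j < d \<Longrightarrow> \<bar>u j - v j\<bar> \<le> eucl_dist d u v"
  unfolding eucl_dist_def
  by (intro real_le_rsqrt) (auto intro!: member_le_sum[of j "{..<d}" "\<lambda>i. (u i - v i)\<^sup>2"])

lemma eucl_dist_le_sum: "eucl_dist d u v \<le> (\<Sum>i<d. \<bar>u i\<bar>) + (\<Sum>i<d. \<bar>v i\<bar>)"
proof -
  have "eucl_dist d u v = L2_set (\<lambda>i. u i - v i) {..<d}" by (simp add: eucl_dist_def L2_set_def)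
  also have "\<dots> \<le> (\<Sum>i<d. \<bar>u i - v i\<bar>)" by (rule L2_set_le_sum_abs)
  also have "\<dots> \<le> (\<Sum>i<d. \<bar>u i\<bar> + \<bar>v i\<bar>)" by (intro sum_mono) auto
  finally show ?thesis by (simp add: sum.distrib)
qed

lemma eucl_dist_nonneg: "0 \<le> eucl_dist d u v"
  by (simp add: eucl_dist_def sum_nonneg)

lemma prob_space_std_gaussian_vec: "prob_space (std_gaussian_vec d)"
  unfolding std_gaussian_vec_def by (intro prob_space_PiM prob_space_std_gaussian)

lemma sets_std_gaussian_vec [measurable_cong]: "sets (std_gaussian_vec d) = sets (PiM {..<d} (\<lambda>_. borel))"
  unfolding std_gaussian_vec_def by (intro sets_PiM_cong) auto

lemma std_gaussian_vec_orthant: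
  assumes [measurable]: "B \<in> sets borel"
  shows "measure (std_gaussian_vec d) {v \<in> space (PiM {..<d} (\<lambda>_. borel)). \<forall>j<d. v j \<in> B}
    = measure std_gaussian B ^ d"
proof -
  interpret G: prob_space std_gaussian by (rule prob_space_std_gaussian)
  interpret product_prob_space "\<lambda>_. std_gaussian" "{..<d}" ..
  have sp: "space (PiM {..<d} (\<lambda>_. borel)) = space (PiM {..<d} (\<lambda>_. std_gaussian))"
    by (simp add: space_PiM)
  have "emeasure (PiM {..<d} (\<lambda>_. std_gaussian))
      {v \<in> space (PiM {..<d} (\<lambda>_. std_gaussian)). \<forall>j\<in>{..<d}. v j \<in> B} = (\<Prod>i<d. emeasure std_gaussian B)"
    by (rule emeasure_PiM_Collect) auto
  also have "\<dots> = ennreal (measure std_gaussian B ^ d)"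
    by (simp add: G.emeasure_eq_measure ennreal_power)
  finally show ?thesis unfolding std_gaussian_vec_def sp
    by (intro measure_eq_emeasure_eq_ennreal) (simp_all only: lessThan_iff Ball_def zero_le_power measure_nonneg)
qed

lemma vec_wasserstein_coupling:
  fixes P :: "(nat \<Rightarrow> real) measure"
  assumes "prob_space P" and sP[measurable_cong]: "sets P = sets (PiM {..<d} (\<lambda>_. borel))"
    and P: "\<And>j. j < d \<Longrightarrow> (\<integral>\<^sup>+u. ennreal \<bar>u j\<bar> \<partial>P) < \<infinity>"
    and W: "wasserstein 1 (eucl_dist d) P (std_gaussian_vec d) \<le> w" "w < w'"
  obtains \<mu> where "\<mu> \<in> couplings P (std_gaussian_vec d)"
    "(\<integral>\<^sup>+z. ennreal (eucl_dist d (fst z) (snd z)) \<partial>\<mu>) \<le> ennreal w'"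
proof -
  let ?Q = "std_gaussian_vec d"
  have c: "P \<Otimes>\<^sub>M ?Q \<in> couplings P ?Q"
    by (rule pair_measure_in_couplings) (fact, rule prob_space_std_gaussian_vec)
  note d = couplingsD[OF c]
  have Q: "(\<integral>\<^sup>+v. ennreal \<bar>v j\<bar> \<partial>?Q) < \<infinity>" if "j < d" for j
  proof -
    have "(\<integral>\<^sup>+v. ennreal \<bar>v j\<bar> \<partial>?Q)
      = (\<integral>\<^sup>+x. ennreal \<bar>x\<bar> \<partial>distr (PiM {..<d} (\<lambda>_. std_gaussian)) std_gaussian (\<lambda>v. v j))"
      unfolding std_gaussian_vec_def using that by (subst nn_integral_distr) auto
    also have "distr (PiM {..<d} (\<lambda>_. std_gaussian)) std_gaussian (\<lambda>v. v j) = std_gaussian"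
      using that by (intro distr_PiM_component) (auto intro: prob_space_std_gaussian)
    finally show ?thesis using std_gaussian_abs_moment[of 1] by simp
  qed
  have mP: "(\<lambda>u. ennreal \<bar>u j\<bar>) \<in> borel_measurable P"
    and mQ: "(\<lambda>u. ennreal \<bar>u j\<bar>) \<in> borel_measurable ?Q" if "j < d" for j
    using measurable_compose[OF measurable_component_singleton[of j "{..<d}" "\<lambda>_. borel"], of "\<lambda>x. ennreal \<bar>x\<bar>"] that
    by (auto simp: measurable_cong_sets[OF sP refl] measurable_cong_sets[OF sets_std_gaussian_vec refl])
  have "(\<integral>\<^sup>+z. ennreal (eucl_dist d (fst z) (snd z)) \<partial>(P \<Otimes>\<^sub>M ?Q))
    \<le> (\<integral>\<^sup>+z. (\<Sum>j<d. ennreal \<bar>fst z j\<bar>) + (\<Sum>j<d. ennreal \<bar>snd z j\<bar>) \<partial>(P \<Otimes>\<^sub>M ?Q))"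
    using eucl_dist_le_sum
    by (intro nn_integral_mono) (simp add: sum_ennreal sum_nonneg flip: ennreal_plus)
  also have "\<dots> = (\<Sum>j<d. \<integral>\<^sup>+u. ennreal \<bar>u j\<bar> \<partial>P) + (\<Sum>j<d. \<integral>\<^sup>+v. ennreal \<bar>v j\<bar> \<partial>?Q)"
  proof -
    have m: "(\<lambda>z. ennreal \<bar>fst z j\<bar>) \<in> borel_measurable (P \<Otimes>\<^sub>M ?Q)"
      "(\<lambda>z. ennreal \<bar>snd z j\<bar>) \<in> borel_measurable (P \<Otimes>\<^sub>M ?Q)" if "j < d" for j
      using measurable_compose[OF d(6) mP[OF that]] measurable_compose[OF d(7) mQ[OF that]] by auto
    show ?thesis
      using coupling_nn_integral(1)[OF c mP] coupling_nn_integral(2)[OF c mQ] m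
      by (subst nn_integral_add)
        (auto simp: nn_integral_sum simp del: sum_ennreal intro!: borel_measurable_sum)
  qed
  also have "\<dots> < \<infinity>" using P Q by simp
  finally have fin: "(\<integral>\<^sup>+z. ennreal (eucl_dist d (fst z) (snd z) powr 1) \<partial>(P \<Otimes>\<^sub>M ?Q)) < \<infinity>"
    by (simp add: eucl_dist_nonneg)
  obtain \<mu> where \<mu>: "\<mu> \<in> couplings P ?Q"
    "(\<integral>\<^sup>+z. ennreal (eucl_dist d (fst z) (snd z) powr 1) \<partial>\<mu>) \<le> ennreal (w' powr 1)"
    by (rule wasserstein_coupling[OF _ c fin W]) auto
  have "0 \<le> w" using W(1) by (rule order_trans[OF wasserstein_nonneg])
  then have "w' powr 1 = w'" using W by simp
  then show ?thesis using \<mu> by (intro that[of \<mu>]) (simp_all add: eucl_dist_nonneg)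
qed

text \<open>If all coordinates of \<open>u\<close> stay below \<open>t\<close> while one of
  \<open>v\<close> exceeds \<open>t + \<eta>\<close>, the Euclidean distance is at least \<eta>. A
  single coordinate decides, so the error \<open>w / \<eta>\<close> carries no further factor
  \<open>d\<close>.\<close>

lemma coupling_orthant_le:
  assumes c: "\<mu> \<in> couplings P (std_gaussian_vec d)"
    and sP[measurable_cong]: "sets P = sets (PiM {..<d} (\<lambda>_. borel))"
    and cost: "(\<integral>\<^sup>+z. ennreal (eucl_dist d (fst z) (snd z)) \<partial>\<mu>) \<le> ennreal w"
    and w: "w \<ge> 0" and s: "\<bar>s\<bar> = 1" and \<eta>: "\<eta> > 0"
  shows "measure P {u \<in> space (PiM {..<d} (\<lambda>_. borel)). \<forall>j<d. s * u j \<le> t}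
    \<le> measure std_gaussian {v. s * v \<le> t + \<eta>} ^ d + w / \<eta>"
proof -
  let ?Q = "std_gaussian_vec d"
  note d = couplingsD[OF c]
  interpret \<mu>: prob_space \<mu> by (rule d)
  have sp: "space P = space (PiM {..<d} (\<lambda>_. borel))" "space ?Q = space (PiM {..<d} (\<lambda>_. borel))"
    using sets_eq_imp_space_eq[OF sP] sets_eq_imp_space_eq[OF sets_std_gaussian_vec] by auto
  have m1: "(\<lambda>z. fst z j) \<in> borel_measurable \<mu>" "(\<lambda>z. snd z j) \<in> borel_measurable \<mu>" if "j < d" for j
  proof -
    have "(\<lambda>u. u j) \<in> borel_measurable P" "(\<lambda>u. u j) \<in> borel_measurable ?Q"
      using measurable_component_singleton[of j "{..<d}" "\<lambda>_. borel"] that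
      by (auto simp: measurable_cong_sets[OF sP refl] measurable_cong_sets[OF sets_std_gaussian_vec refl])
    then show "(\<lambda>z. fst z j) \<in> borel_measurable \<mu>" "(\<lambda>z. snd z j) \<in> borel_measurable \<mu>"
      using measurable_compose[OF d(6)] measurable_compose[OF d(7)] by blast+
  qed
  have [measurable]: "(\<lambda>z. eucl_dist d (fst z) (snd z)) \<in> borel_measurable \<mu>"
    unfolding eucl_dist_def 
    by (rule borel_measurable_sqrt[THEN measurable_compose[rotated]],
        intro borel_measurable_sum borel_measurable_power borel_measurable_diff m1) auto
  have "measure P {u \<in> space (PiM {..<d} (\<lambda>_. borel)). \<forall>j<d. s * u j \<le> t}
     \<le> measure ?Q {v \<in> space (PiM {..<d} (\<lambda>_. borel)). \<forall>j<d. v j \<in> {v. s * v \<le> t + \<eta>}}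
      + measure \<mu> {z \<in> space \<mu>. eucl_dist d (fst z) (snd z) \<ge> \<eta>}"
  proof (rule coupling_measure_le[OF c])
    have "{u \<in> space (PiM {..<d} (\<lambda>_. borel)). \<forall>j\<in>{..<d}. s * u j \<le> t'} \<in> sets (PiM {..<d} (\<lambda>_. borel))" for t'
      by measurable
    then show "{u \<in> space (PiM {..<d} (\<lambda>_. borel)). \<forall>j<d. s * u j \<le> t} \<in> sets P"
      "{v \<in> space (PiM {..<d} (\<lambda>_. borel)). \<forall>j<d. v j \<in> {v. s * v \<le> t + \<eta>}} \<in> sets ?Q"
      unfolding sP sets_std_gaussian_vec by (auto simp: lessThan_iff Ball_def)
    show "{z \<in> space \<mu>. eucl_dist d (fst z) (snd z) \<ge> \<eta>} \<in> sets \<mu>" by measurable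
    fix u v assume u: "u \<in> {u \<in> space (PiM {..<d} (\<lambda>_. borel)). \<forall>j<d. s * u j \<le> t}"
      and v: "v \<in> space ?Q" "v \<notin> {v \<in> space (PiM {..<d} (\<lambda>_. borel)). \<forall>j<d. v j \<in> {v. s * v \<le> t + \<eta>}}"
    then obtain j where j: "j < d" "s * v j > t + \<eta>" using sp by auto
    then have "\<eta> \<le> s * (v j - u j)" using u by (fastforce simp: algebra_simps)
    also have "\<dots> \<le> \<bar>v j - u j\<bar>" using s by (metis abs_ge_self abs_mult mult_1)
    also have "\<dots> \<le> eucl_dist d u v" using eucl_dist_ge_component[OF j(1), of u v] by linarith
    finally show "(u, v) \<in> {z \<in> space \<mu>. eucl_dist d (fst z) (snd z) \<ge> \<eta>}"
      using u v sp d(3) by auto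
  qed
  also have "measure ?Q {v \<in> space (PiM {..<d} (\<lambda>_. borel)). \<forall>j<d. v j \<in> {v. s * v \<le> t + \<eta>}}
    = measure std_gaussian {v. s * v \<le> t + \<eta>} ^ d"
    by (rule std_gaussian_vec_orthant) measurable
  also have "measure \<mu> {z \<in> space \<mu>. eucl_dist d (fst z) (snd z) \<ge> \<eta>} \<le> w / \<eta>"
    using \<eta> w cost by (intro markov_measure_le) (auto simp: \<mu>.finite_measure_axioms)
  finally show ?thesis by simp
qed

section \<open>Random variables close to a Gaussian law\<close>

context prob_space
begin

lemma wasserstein_gaussian_coupling:
  fixes Y :: "'a \<Rightarrow> real"
  assumes [measurable]: "Y \<in> borel_measurable M" and int: "integrable M (\<lambda>\<omega>. \<bar>Y \<omega>\<bar> ^ p)"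
    and p: "p \<ge> 1"
    and W: "wasserstein (real p) (\<lambda>x y. \<bar>x - y\<bar>) (distr M borel Y) std_gaussian \<le> w" "w < w'"
  obtains \<mu> where "\<mu> \<in> couplings (distr M borel Y) std_gaussian"
    "(\<integral>\<^sup>+z. ennreal (\<bar>fst z - snd z\<bar> ^ p) \<partial>\<mu>) \<le> ennreal (w' ^ p)"
proof (rule real_wasserstein_coupling[OF _ prob_space_std_gaussian _ _ _ std_gaussian_abs_moment p W])
  show "prob_space (distr M borel Y)" by (rule prob_space_distr) measurable
  have "(\<integral>\<^sup>+u. ennreal (\<bar>u\<bar> ^ p) \<partial>distr M borel Y) = (\<integral>\<^sup>+\<omega>. ennreal (\<bar>Y \<omega>\<bar> ^ p) \<partial>M)"
    by (rule nn_integral_distr) measurable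
  also have "\<dots> < \<infinity>" using int by (simp add: integrable_iff_bounded)
  finally show "(\<integral>\<^sup>+u. ennreal (\<bar>u\<bar> ^ p) \<partial>distr M borel Y) < \<infinity>" .
qed (use that in auto)

lemma wasserstein_gaussian_tail:
  fixes Y :: "'a \<Rightarrow> real"
  assumes [measurable]: "Y \<in> borel_measurable M" and int: "integrable M (\<lambda>\<omega>. \<bar>Y \<omega>\<bar> ^ p)"
    and p: "p \<ge> 1"
    and W: "wasserstein (real p) (\<lambda>x y. \<bar>x - y\<bar>) (distr M borel Y) std_gaussian \<le> w" "w < w'"
    and s: "\<bar>s\<bar> = 1" and x: "x \<ge> 0" and y: "y > 0"
  shows "prob {\<omega> \<in> space M. s * Y \<omega> > x + y} \<le> exp (- x\<^sup>2 / 2) + (w' / y) ^ p"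
proof -
  obtain \<mu> where \<mu>: "\<mu> \<in> couplings (distr M borel Y) std_gaussian"
    "(\<integral>\<^sup>+z. ennreal (\<bar>fst z - snd z\<bar> ^ p) \<partial>\<mu>) \<le> ennreal (w' ^ p)"
    using wasserstein_gaussian_coupling[OF assms(1-5)] by blast
  have "w' \<ge> 0" using order_trans[OF wasserstein_nonneg W(1)] W(2) by simp
  have "prob {\<omega> \<in> space M. s * Y \<omega> > x + y} = measure (distr M borel Y) {u. s * u > x + y}"
    by (subst measure_distr) (auto simp: vimage_def intro!: arg_cong[where f = prob])
  also have "\<dots> \<le> measure std_gaussian {v. s * v > x} + (w' / y) ^ p"
    by (rule coupling_tail_le[OF \<mu>(1) _ _ \<mu>(2) \<open>w' \<ge> 0\<close> s y]) auto
  finally show ?thesis using std_gaussian_tail_le[OF s x] by linarith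
qed

text \<open>Meant for a bounded, not necessarily small \<open>w'\<close>: closeness to the Gaussian
  then bounds the moments uniformly, and Markov's inequality gives polynomial tails of every
  order.\<close>

lemma wasserstein_gaussian_moment_tail:
  fixes Y :: "'a \<Rightarrow> real"
  assumes [measurable]: "Y \<in> borel_measurable M" and int: "integrable M (\<lambda>\<omega>. \<bar>Y \<omega>\<bar> ^ p)"
    and p: "p \<ge> 1"
    and W: "wasserstein (real p) (\<lambda>x y. \<bar>x - y\<bar>) (distr M borel Y) std_gaussian \<le> w" "w < w'"
    and y: "y > 0"
  shows "prob {\<omega> \<in> space M. \<bar>Y \<omega>\<bar> \<ge> y}
    \<le> 2 ^ p * (w' ^ p + enn2real (\<integral>\<^sup>+v. ennreal (\<bar>v\<bar> ^ p) \<partial>std_gaussian)) / y ^ p"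
proof -
  define m where "m = enn2real (\<integral>\<^sup>+v. ennreal (\<bar>v\<bar> ^ p) \<partial>std_gaussian)"
  have m: "(\<integral>\<^sup>+v. ennreal (\<bar>v\<bar> ^ p) \<partial>std_gaussian) = ennreal m" "m \<ge> 0"
    using std_gaussian_abs_moment[of p] by (auto simp: m_def)
  obtain \<mu> where \<mu>: "\<mu> \<in> couplings (distr M borel Y) std_gaussian"
    "(\<integral>\<^sup>+z. ennreal (\<bar>fst z - snd z\<bar> ^ p) \<partial>\<mu>) \<le> ennreal (w' ^ p)"
    using wasserstein_gaussian_coupling[OF assms(1-5)] by blast
  have w': "w' \<ge> 0" using order_trans[OF wasserstein_nonneg W(1)] W(2) by simp
  have "(\<integral>\<^sup>+\<omega>. ennreal (\<bar>Y \<omega>\<bar> ^ p) \<partial>M) = (\<integral>\<^sup>+u. ennreal (\<bar>u\<bar> ^ p) \<partial>distr M borel Y)"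
    by (rule nn_integral_distr[symmetric]) measurable
  also have "\<dots> \<le> 2 ^ p * (ennreal (w' ^ p) + ennreal m)"
    using coupling_moment_le[OF \<mu>(1) _ _ \<mu>(2)] m by simp
  also have "\<dots> = ennreal (2 ^ p * (w' ^ p + m))"
    using w' m by (simp add: ennreal_mult ennreal_plus flip: ennreal_power)
  finally have "prob {\<omega> \<in> space M. y ^ p \<le> \<bar>Y \<omega>\<bar> ^ p} \<le> 2 ^ p * (w' ^ p + m) / y ^ p"
    using y w' m by (intro markov_measure_le) (auto simp: finite_measure_axioms)
  moreover have "y ^ p \<le> \<bar>Y \<omega>\<bar> ^ p \<longleftrightarrow> y \<le> \<bar>Y \<omega>\<bar>" for \<omega>
    using y p by (intro power_mono_iff) auto
  ultimately show ?thesis by (simp add: m_def)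
qed

text \<open>In \<open>t + 2\<close>, one unit is the slack \<eta> = 1 granted to the coupling and
  one is lost in the lower bound for the Gaussian tail.\<close>

lemma wasserstein_gaussian_orthant:
  fixes Y :: "nat \<Rightarrow> 'a \<Rightarrow> real"
  assumes [measurable]: "\<And>j. Y j \<in> borel_measurable M" and int: "\<And>j. integrable M (Y j)"
    and W: "wasserstein 1 (eucl_dist d) (distr M (PiM {..<d} (\<lambda>_. borel)) (\<lambda>\<omega>. \<lambda>j\<in>{..<d}. Y j \<omega>))
        (std_gaussian_vec d) \<le> w" "w < w'"
    and s: "\<bar>s\<bar> = 1" and t: "t \<ge> 0"
  shows "prob {\<omega> \<in> space M. \<forall>j<d. s * Y j \<omega> \<le> t} \<le> (1 - exp (- (t + 2)\<^sup>2 / 2) / 3) ^ d + w'"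
proof -
  interpret G: prob_space std_gaussian by (rule prob_space_std_gaussian)
  let ?Z = "\<lambda>\<omega>. \<lambda>j\<in>{..<d}. Y j \<omega>" and ?B = "PiM {..<d} (\<lambda>_. borel :: real measure)"
  let ?P = "distr M ?B ?Z"
  have Z [measurable]: "?Z \<in> measurable M ?B" by measurable
  have sets: "sets ?P = sets ?B" by simp
  have fin: "(\<integral>\<^sup>+u. ennreal \<bar>u j\<bar> \<partial>?P) < \<infinity>" if "j < d" for j
  proof -
    have "(\<lambda>u. u j) \<in> borel_measurable ?B"
      using that by (intro measurable_component_singleton) auto
    then have "(\<integral>\<^sup>+u. ennreal \<bar>u j\<bar> \<partial>?P) = (\<integral>\<^sup>+\<omega>. ennreal \<bar>Y j \<omega>\<bar> \<partial>M)"
      using that by (subst nn_integral_distr) auto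
    also have "\<dots> < \<infinity>" using int[of j] by (simp add: integrable_iff_bounded)
    finally show ?thesis .
  qed
  obtain \<mu> where \<mu>: "\<mu> \<in> couplings ?P (std_gaussian_vec d)"
    "(\<integral>\<^sup>+z. ennreal (eucl_dist d (fst z) (snd z)) \<partial>\<mu>) \<le> ennreal w'"
    by (rule vec_wasserstein_coupling[OF prob_space_distr[OF Z] sets fin W])
  have w': "w' \<ge> 0" using order_trans[OF wasserstein_nonneg W(1)] W(2) by simp
  have "{u \<in> space ?B. \<forall>j\<in>{..<d}. s * u j \<le> t} \<in> sets ?B" by measurable
  then have "prob {\<omega> \<in> space M. \<forall>j<d. s * Y j \<omega> \<le> t} = measure ?P {u \<in> space ?B. \<forall>j<d. s * u j \<le> t}"
    using measurable_space[OF Z]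
    by (subst measure_distr[OF Z]) (auto intro!: arg_cong[where f = prob] simp: Ball_def)
  also have "\<dots> \<le> measure std_gaussian {v. s * v \<le> t + 1} ^ d + w' / 1"
    by (rule coupling_orthant_le[OF \<mu>(1) sets \<mu>(2) w' s]) simp
  also have "measure std_gaussian {v. s * v \<le> t + 1} = 1 - measure std_gaussian {v. s * v > t + 1}"
  proof -
    have "{v. s * v > t + 1} \<in> sets std_gaussian" by (simp, measurable)
    from G.prob_compl[OF this] show ?thesis by (simp add: Compl_eq not_less flip: Compl_eq_Diff_UNIV)
  qed
  also have "(1 - measure std_gaussian {v. s * v > t + 1}) ^ d \<le> (1 - exp (- (t + 2)\<^sup>2 / 2) / 3) ^ d"
    using std_gaussian_tail_ge[OF s, of "t + 1"] t by (intro power_mono) (auto simp: add.assoc)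
  finally show ?thesis by simp
qed

end

lemma slowly_varying_double:
  fixes g :: "nat \<Rightarrow> real"
  assumes L: "slowly_varying L" and g: "\<And>n. g n > 0"
    and asym: "(\<lambda>n. g n / (real n powr a * L (real n))) \<longlonglongrightarrow> 1"
  shows "(\<lambda>i. g (2 ^ Suc i) / g (2 ^ i)) \<longlonglongrightarrow> 2 powr a"
proof -
  define u where "u n = g n / (real n powr a * L (real n))" for n
  have pow: "filterlim (\<lambda>i. 2 ^ i :: nat) at_top sequentially"
    by (rule filterlim_subseq) (simp add: strict_mono_def)
  have pow': "filterlim (\<lambda>i. 2 ^ Suc i :: nat) at_top sequentially"
    by (rule filterlim_subseq) (simp add: strict_mono_def)
  have u1: "(\<lambda>i. u (2 ^ i)) \<longlonglongrightarrow> 1" "(\<lambda>i. u (2 ^ Suc i)) \<longlonglongrightarrow> 1"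
    using asym filterlim_compose[OF _ pow] filterlim_compose[OF _ pow'] unfolding u_def by blast+
  have "((\<lambda>x. L (2 * x) / L x) \<longlongrightarrow> 1) at_top" using L by (simp add: slowly_varying_def)
  moreover have "filterlim (\<lambda>i. real (2 ^ i)) at_top sequentially"
    by (rule filterlim_compose[OF filterlim_real_sequentially pow])
  ultimately have L1: "(\<lambda>i. L (2 * real (2 ^ i)) / L (real (2 ^ i))) \<longlonglongrightarrow> 1"
    by (rule filterlim_compose)
  have "(\<lambda>i. u (2 ^ Suc i) / u (2 ^ i) * 2 powr a * (L (2 * real (2 ^ i)) / L (real (2 ^ i)))) \<longlonglongrightarrow> 1 / 1 * 2 powr a * 1"
    by (intro tendsto_intros u1 L1) simp
  moreover have "\<forall>\<^sub>F i in sequentially. u (2 ^ Suc i) / u (2 ^ i) * 2 powr a * (L (2 * real (2 ^ i)) / L (real (2 ^ i)))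
      = g (2 ^ Suc i) / g (2 ^ i)"
    using order_tendstoD(1)[OF u1(1) zero_less_one] order_tendstoD(1)[OF u1(2) zero_less_one]
  proof eventually_elim
    case (elim i)
    \<comment> \<open>Division by zero yields 0, so positivity of \<open>u\<close> at both points
      shows that \<open>L\<close> does not vanish there.\<close>
    have nz: "L (real (2 ^ i)) \<noteq> 0" "L (2 * real (2 ^ i)) \<noteq> 0" using elim by (auto simp: u_def)
    have "real (2 ^ Suc i) powr a = 2 powr a * real (2 ^ i) powr a" by (simp add: powr_mult)
    moreover have "real (2 ^ Suc i) = 2 * real (2 ^ i)" by simp
    moreover have "real (2 ^ i) powr a > 0" by simp
    ultimately show ?case using nz g[of "2 ^ i"] unfolding u_def by (simp add: field_simps)
  qed
  ultimately show ?thesis by (simp add: tendsto_cong)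
qed

subsection \<open>The upper bound\<close>

text \<open>Minkowski's inequality from \<open>2 * f * h \<le> B / A * f^2 + A / B * h^2\<close>,
  which is sharp when \<open>A\<close> and \<open>B\<close> are the two norms. Adding
  \<open>e / 2\<close> keeps them positive when a norm vanishes.\<close>

lemma L2_triangle:
  fixes f h :: "'a \<Rightarrow> real"
  assumes [measurable]: "f \<in> borel_measurable N" "h \<in> borel_measurable N"
    and f: "integrable N (\<lambda>x. (f x)\<^sup>2)" and h: "integrable N (\<lambda>x. (h x)\<^sup>2)"
  shows "sqrt (\<integral>x. (f x + h x)\<^sup>2 \<partial>N) \<le> sqrt (\<integral>x. (f x)\<^sup>2 \<partial>N) + sqrt (\<integral>x. (h x)\<^sup>2 \<partial>N)"
proof (rule field_le_epsilon)
  fix e :: real assume e: "e > 0"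
  define A B where "A = sqrt (\<integral>x. (f x)\<^sup>2 \<partial>N) + e / 2" and "B = sqrt (\<integral>x. (h x)\<^sup>2 \<partial>N) + e / 2"
  have AB: "A > 0" "B > 0" using e by (auto simp: A_def B_def add_nonneg_pos)
  have fA: "(\<integral>x. (f x)\<^sup>2 \<partial>N) \<le> A\<^sup>2" and hB: "(\<integral>x. (h x)\<^sup>2 \<partial>N) \<le> B\<^sup>2"
    using e by (auto simp: A_def B_def intro!: sqrt_le_D)
  have pt: "(f x + h x)\<^sup>2 \<le> (1 + B / A) * (f x)\<^sup>2 + (1 + A / B) * (h x)\<^sup>2" for x
  proof -
    have "0 \<le> (B * f x - A * h x)\<^sup>2 / (A * B)" using AB by simp
    also have "\<dots> = B / A * (f x)\<^sup>2 + A / B * (h x)\<^sup>2 - 2 * f x * h x"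
      using AB by (simp add: field_simps power2_eq_square)
    finally show ?thesis by (simp add: power2_sum algebra_simps)
  qed
  have "(\<integral>x. (f x + h x)\<^sup>2 \<partial>N) \<le> (\<integral>x. (1 + B / A) * (f x)\<^sup>2 + (1 + A / B) * (h x)\<^sup>2 \<partial>N)"
    using pt f h AB by (intro integral_mono') auto
  also have "\<dots> = (1 + B / A) * (\<integral>x. (f x)\<^sup>2 \<partial>N) + (1 + A / B) * (\<integral>x. (h x)\<^sup>2 \<partial>N)"
    using f h by simp
  also have "\<dots> \<le> (1 + B / A) * A\<^sup>2 + (1 + A / B) * B\<^sup>2"
    using AB fA hB by (intro add_mono mult_left_mono) auto
  also have "\<dots> = (A + B)\<^sup>2" using AB by (simp add: field_simps power2_eq_square)
  finally have "sqrt (\<integral>x. (f x + h x)\<^sup>2 \<partial>N) \<le> A + B"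
    using AB by (intro real_le_lsqrt) auto
  then show "sqrt (\<integral>x. (f x + h x)\<^sup>2 \<partial>N)
      \<le> sqrt (\<integral>x. (f x)\<^sup>2 \<partial>N) + sqrt (\<integral>x. (h x)\<^sup>2 \<partial>N) + e"
    by (simp add: A_def B_def)
qed

section \<open>The process and its maximal inequality\<close>

definition llog :: "nat \<Rightarrow> real" where
  "llog n = sqrt (2 * ln (ln (real n)))"

text \<open>\<open>ln (ln m)\<close> may be negative here; \<open>sqrt\<close> is increasing on the
  whole real line, with negative values at negative arguments.\<close>

lemma llog_mono:
  assumes "2 \<le> m" "m \<le> n" shows "llog m \<le> llog n"
proof -
  have "0 < ln (real m)" using assms by simp
  moreover have "ln (real m) \<le> ln (real n)" using assms by simp
  ultimately show ?thesis unfolding llog_def by (simp add: real_sqrt_le_iff)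
qed

lemma llog_at_top: "filterlim llog at_top sequentially"
  unfolding llog_def by real_asymp

text \<open>\<open>gaussian_tail\<close> and \<open>block\<close> are one-sided, because the locale
  is used for the process and for its negative. Both tail assumptions distil the Wasserstein bounds
  of integer order, with \<open>K\<close> depending on the order alone. \<open>block\<close> is (A4)
  with as many increments as the offset \<open>m\<close>, so that the block consists of the indices
  \<open>m + 1\<close> to \<open>3 * m\<close>.\<close>

locale lil_process = prob_space M for M :: "'s measure" +
  fixes X :: "nat \<Rightarrow> 's \<Rightarrow> real" and g :: "nat \<Rightarrow> real" and r :: real
  assumes meas [measurable]: "\<And>n. X n \<in> borel_measurable M"
    and X0: "\<And>\<omega>. \<omega> \<in> space M \<Longrightarrow> X 0 \<omega> = 0"
    and sq_int: "\<And>m n. integrable M (\<lambda>\<omega>. (X n \<omega> - X m \<omega>)\<^sup>2)"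
    and g_pos: "\<And>n. g n > 0"
    and variance: "\<exists>C>0. \<forall>m n. m < n \<longrightarrow>
        \<bar>expectation (\<lambda>\<omega>. ((X n \<omega> - X m \<omega>) / g (n - m))\<^sup>2) - 1\<bar> \<le> C / (1 + ln (real (n - m)))"
    and g_double: "(\<lambda>i. g (2 ^ Suc i) / g (2 ^ i)) \<longlonglongrightarrow> r" and r_gt: "r > 1"
    and moment_tail: "\<And>p. p \<ge> 1 \<Longrightarrow> \<exists>K\<ge>0. \<forall>m n y. m < n \<longrightarrow> y > 0 \<longrightarrow>
        prob {\<omega> \<in> space M. \<bar>X n \<omega> - X m \<omega>\<bar> \<ge> y} \<le> K * (g (n - m) / y) ^ p"
    and gaussian_tail: "\<And>p. p \<ge> 1 \<Longrightarrow> \<exists>K\<ge>0. \<forall>m n x y. m < n \<longrightarrow> x \<ge> 0 \<longrightarrow> y > 0 \<longrightarrow>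
        prob {\<omega> \<in> space M. X n \<omega> - X m \<omega> > (x + y) * g (n - m)}
          \<le> exp (- x\<^sup>2 / 2) + K / (y * (1 + ln (real (n - m)))) ^ p"
    and block: "\<exists>c>0. \<forall>\<alpha>>0. \<exists>C\<ge>0. \<forall>m t. m \<ge> 1 \<longrightarrow> t \<ge> 0 \<longrightarrow>
        (let N = (\<lambda>i::nat. nat \<lfloor>exp (c * real i powr (1 + \<alpha>))\<rfloor>)
         in prob {\<omega> \<in> space M. \<forall>j<m. X (N (m + 2 * j + 2)) \<omega> - X (N (m + 2 * j + 1)) \<omega>
                    \<le> t * g (N (m + 2 * j + 2) - N (m + 2 * j + 1))}
            \<le> (1 - exp (- (t + 2)\<^sup>2 / 2) / 3) ^ m
              + real m * C / (1 + ln (real (N (m + 2) - N (m + 1)))))"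
begin

definition L2d :: "nat \<Rightarrow> nat \<Rightarrow> real" where
  "L2d m n = sqrt (expectation (\<lambda>\<omega>. (X n \<omega> - X m \<omega>)\<^sup>2))"

lemma growth_gauge: obtains K where "growth_gauge g L2d K r"
proof -
  obtain C where C: "C > 0" "\<And>m n. m < n \<Longrightarrow>
        \<bar>expectation (\<lambda>\<omega>. ((X n \<omega> - X m \<omega>) / g (n - m))\<^sup>2) - 1\<bar> \<le> C / (1 + ln (real (n - m)))"
    using variance by blast
  have scale: "expectation (\<lambda>\<omega>. (X n \<omega> - X m \<omega>)\<^sup>2)
      = (g (n - m))\<^sup>2 * expectation (\<lambda>\<omega>. ((X n \<omega> - X m \<omega>) / g (n - m))\<^sup>2)" for m n
    using g_pos[of "n - m"] by (simp add: power_divide)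
  have L2d_eq: "L2d m n = g (n - m) * sqrt (expectation (\<lambda>\<omega>. ((X n \<omega> - X m \<omega>) / g (n - m))\<^sup>2))" for m n
    unfolding L2d_def scale using g_pos[of "n - m"] by (simp add: real_sqrt_mult)
  have "growth_gauge g L2d (sqrt (1 + C)) r"
  proof
    show "g n > 0" for n by (rule g_pos)
    show "L2d n n = 0" for n by (simp add: L2d_def)
    show "L2d i j = L2d j i" for i j by (simp add: L2d_def power2_commute)
    show "L2d i k \<le> L2d i j + L2d j k" for i j k
      unfolding L2d_def
      using L2_triangle[of "\<lambda>\<omega>. X j \<omega> - X i \<omega>" M "\<lambda>\<omega>. X k \<omega> - X j \<omega>"] sq_int by simp
    show "L2d m n \<le> sqrt (1 + C) * g (n - m)" if "m < n" for m n
    proof -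
      have "0 \<le> ln (real (n - m))" using that by (intro ln_ge_zero) linarith
      then have "C / (1 + ln (real (n - m))) \<le> C / 1" using C(1) by (intro divide_left_mono) auto
      then have "expectation (\<lambda>\<omega>. ((X n \<omega> - X m \<omega>) / g (n - m))\<^sup>2) \<le> 1 + C"
        using C(2)[OF that] by linarith
      then show ?thesis unfolding L2d_eq using g_pos[of "n - m"]
        by (simp add: mult.commute)
    qed
    show "(\<lambda>n. L2d 0 n / g n) \<longlonglongrightarrow> 1"
    proof -
      have "(\<lambda>n. expectation (\<lambda>\<omega>. ((X n \<omega> - X 0 \<omega>) / g n)\<^sup>2) - 1) \<longlonglongrightarrow> 0"
      proof (rule Lim_null_comparison)
        show "\<forall>\<^sub>F n in sequentially. norm (expectation (\<lambda>\<omega>. ((X n \<omega> - X 0 \<omega>) / g n)\<^sup>2) - 1)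
            \<le> C / (1 + ln (real n))"
          using eventually_gt_at_top[of 0] by eventually_elim (use C(2)[of 0] in auto)
        show "(\<lambda>n. C / (1 + ln (real n))) \<longlonglongrightarrow> 0" by real_asymp
      qed
      then have "(\<lambda>n. sqrt (expectation (\<lambda>\<omega>. ((X n \<omega> - X 0 \<omega>) / g n)\<^sup>2))) \<longlonglongrightarrow> sqrt 1"
        by (intro tendsto_real_sqrt) (simp add: LIM_zero_iff)
      then show ?thesis unfolding L2d_eq using g_pos by (simp add: less_imp_neq[symmetric])
    qed
    show "(\<lambda>i. g (2 ^ Suc i) / g (2 ^ i)) \<longlonglongrightarrow> r" "r > 1" by (fact g_double r_gt)+
    show "sqrt (1 + C) > 0" using C by simp
  qed
  then show ?thesis by (rule that)
qed

lemma potter: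
  obtains C b where "C > 0" "b > 0"
    "\<And>m n. 1 \<le> m \<Longrightarrow> m \<le> n \<Longrightarrow> g m \<le> C * (real m / real n) powr b * g n"
proof -
  obtain K where "growth_gauge g L2d K r" by (rule growth_gauge)
  then interpret growth_gauge g L2d K r .
  show ?thesis using potter_bound that by blast
qed

lemma g_near:
  assumes "e > 0"
  obtains \<delta> where "\<delta> > 0"
    "\<forall>\<^sub>F n in sequentially. \<forall>m\<le>n. real (n - m) \<le> \<delta> * real n \<longrightarrow> \<bar>g m - g n\<bar> \<le> e * g n"
proof -
  obtain K where "growth_gauge g L2d K r" by (rule growth_gauge)
  then interpret growth_gauge g L2d K r .
  show ?thesis using g_close[OF assms] that by blast
qed

text \<open>Dyadic chaining: at scale \<open>2 ^ i\<close> there are \<open>2 ^ (N - i)\<close> increments, each of relative size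
  \<open>2 powr (- b * (N - i))\<close>, so a moment of order \<open>p > 2 / b\<close> pays for the union bound.\<close>
lemma maximal_inequality:
  obtains p0 where "\<And>p. p \<ge> p0 \<Longrightarrow> \<exists>K\<ge>0. \<forall>n N y. y > 0 \<longrightarrow>
    prob {\<omega> \<in> space M. \<exists>j<2 ^ N. \<bar>X (n + j) \<omega> - X n \<omega>\<bar> > y * g (2 ^ N)} \<le> K / y ^ p"
proof -
  obtain C b where C: "C > 0" "b > 0"
    "\<And>m n. 1 \<le> m \<Longrightarrow> m \<le> n \<Longrightarrow> g m \<le> C * (real m / real n) powr b * g n"
    using potter by blast
  \<comment> \<open>Halving the length costs \<open>g\<close> a factor \<rho> squared. One \<rho>
    per scale goes into the thresholds \<open>x i\<close>, which makes them summable; the other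
    stays in the ratio \<open>g (2 ^ i) / x i\<close> and is raised to the power
    \<open>p\<close>.\<close>
  define \<rho> where "\<rho> = 2 powr (- b / 2)"
  have \<rho>: "0 < \<rho>" "\<rho> < 1" using C powr_less_cancel_iff[of 2 "- b / 2" 0] by (auto simp: \<rho>_def)
  have \<rho>2: "2 powr (- b) = \<rho>\<^sup>2" by (simp add: \<rho>_def power2_eq_square flip: powr_add)
  have growth: "g (2 ^ i) \<le> C * (\<rho>\<^sup>2) ^ (N - i) * g (2 ^ N)" if "i < N" for i N
  proof -
    have "real (2 ^ i) / real (2 ^ N) = 2 powr (- real (N - i))"
    proof -
      have "(2::real) ^ N = 2 ^ (N - i) * 2 ^ i" using that by (simp flip: power_add)
      then show ?thesis by (simp only: powr_minus powr_realpow) (simp add: field_simps powr_realpow)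
    qed
    then have "(real (2 ^ i) / real (2 ^ N)) powr b = (\<rho>\<^sup>2) ^ (N - i)"
      by (simp add: powr_powr mult.commute flip: \<rho>2 powr_realpow)
    then show ?thesis using C(3)[of "2 ^ i" "2 ^ N"] that by simp
  qed
  \<comment> \<open>Ensures \<open>2 * \<rho> ^ p \<le> 1 / 2\<close>, so that the
    \<open>p\<close>-th power beats the \<open>2 ^ (N - i)\<close> intervals of scale
    \<open>i\<close> with a geometric series to spare. Taking \<open>p \<ge> p1 + 1\<close> also
    makes \<open>p\<close> at least 1.\<close>
  obtain p1 where p1: "\<rho> ^ p1 < 1 / 4" using real_arch_pow_inv[of "1/4" \<rho>] \<rho> by auto
  define S where "S = \<rho> / (1 - \<rho>)"
  have S: "S > 0" using \<rho> by (simp add: S_def)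
  have S_ge: "(\<Sum>i<N. \<rho> ^ (N - i)) \<le> S" for N
  proof -
    have "(\<Sum>i<N. \<rho> ^ (N - i)) = (\<Sum>i<N. \<rho> * \<rho> ^ i)"
      by (rule sum.reindex_bij_witness[of _ "\<lambda>i. N - 1 - i" "\<lambda>i. N - 1 - i"])
        (auto simp flip: power_Suc simp: Suc_diff_Suc)
    also have "\<dots> = \<rho> * (\<Sum>i<N. \<rho> ^ i)" by (simp add: sum_distrib_left)
    also have "\<dots> \<le> \<rho> * (\<Sum>i. \<rho> ^ i)"
      using \<rho> by (intro mult_left_mono sum_le_suminf summable_geometric) auto
    also have "\<dots> = S" using \<rho> by (simp add: suminf_geometric S_def)
    finally show ?thesis .
  qed
  show ?thesis
  proof (rule that[of "p1 + 1"])
    fix p assume p: "p \<ge> p1 + 1"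
    obtain K where K: "K \<ge> 0" "\<And>m n y. m < n \<Longrightarrow> y > 0 \<Longrightarrow>
        prob {\<omega> \<in> space M. \<bar>X n \<omega> - X m \<omega>\<bar> \<ge> y} \<le> K * (g (n - m) / y) ^ p"
      using moment_tail[of p] p by auto
    have rp: "2 * \<rho> ^ p \<le> 1 / 2"
    proof -
      have "\<rho> ^ p \<le> \<rho> ^ p1" using \<rho> p by (intro power_decreasing) auto
      then show ?thesis using p1 by simp
    qed
    have geo: "(\<Sum>i<N. (2 * \<rho> ^ p) ^ (N - i)) \<le> 1" for N
    proof -
      have "(\<Sum>i<N. (2 * \<rho> ^ p) ^ (N - i)) \<le> (\<Sum>i<N. (1 / 2) ^ (N - i))"
        using rp \<rho> by (intro sum_mono power_mono) auto
      also have "(\<Sum>i<N. (1 / 2 :: real) ^ (N - i)) = (\<Sum>i<N. (1 / 2) ^ Suc i)"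
        by (rule sum.reindex_bij_witness[of _ "\<lambda>i. N - 1 - i" "\<lambda>i. N - 1 - i"])
          (auto simp: Suc_diff_Suc simp del: power_Suc)
      also have "\<dots> \<le> (\<Sum>i. (1 / 2) ^ Suc i)"
        by (intro sum_le_suminf sums_summable[OF power_half_series]) auto
      also have "\<dots> = 1" using power_half_series by (rule sums_unique[symmetric])
      finally show ?thesis .
    qed
    have "prob {\<omega> \<in> space M. \<exists>j<2 ^ N. \<bar>X (n + j) \<omega> - X n \<omega>\<bar> > y * g (2 ^ N)} \<le> K * (C * S) ^ p / y ^ p"
      if y: "y > 0" for n N y
    proof -
      \<comment> \<open>Dividing by \<open>S\<close> makes the thresholds add up to at most
        \<open>y * g (2 ^ N)\<close>.\<close>
      define x where "x i = y / S * \<rho> ^ (N - i) * g (2 ^ N)" for i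
      have x: "x i > 0" for i using y S \<rho> g_pos by (simp add: x_def)
      define E where "E i l = {\<omega> \<in> space M. \<bar>X (n + (l + 1) * 2 ^ i) \<omega> - X (n + l * 2 ^ i) \<omega>\<bar> \<ge> x i}" for i l
      have [measurable]: "E i l \<in> sets M" for i l unfolding E_def by measurable
      have sub: "{\<omega> \<in> space M. \<exists>j<2 ^ N. \<bar>X (n + j) \<omega> - X n \<omega>\<bar> > y * g (2 ^ N)}
          \<subseteq> (\<Union>i<N. \<Union>l<2 ^ (N - i). E i l)"
      proof (rule subsetI, rule ccontr)
        fix \<omega> assume "\<omega> \<in> {\<omega> \<in> space M. \<exists>j<2 ^ N. \<bar>X (n + j) \<omega> - X n \<omega>\<bar> > y * g (2 ^ N)}"
        then obtain j where \<omega>: "\<omega> \<in> space M" "j < 2 ^ N" "\<bar>X (n + j) \<omega> - X n \<omega>\<bar> > y * g (2 ^ N)" by auto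
        assume nE: "\<omega> \<notin> (\<Union>i<N. \<Union>l<2 ^ (N - i). E i l)"
        have "\<bar>X (n + j) \<omega> - X n \<omega>\<bar> \<le> (\<Sum>i<N. x i)"
        proof (rule dyadic_chain[where d = "\<lambda>m n. \<bar>X n \<omega> - X m \<omega>\<bar>", OF _ _ _ _ \<omega>(2)])
          fix i l assume i: "i < N" "(l + 1) * 2 ^ i \<le> (2::nat) ^ N"
          have "(2::nat) ^ N = 2 ^ (N - i) * 2 ^ i" using i by (simp flip: power_add)
          then have "(l + 1) * 2 ^ i \<le> 2 ^ (N - i) * 2 ^ i" using i(2) by (simp only:)
          then have "l < 2 ^ (N - i)" by (simp only: mult_le_cancel2) simp
          then show "\<bar>X (n + (l + 1) * 2 ^ i) \<omega> - X (n + l * 2 ^ i) \<omega>\<bar> \<le> x i"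
            using nE i(1) \<omega>(1) by (force simp: E_def)
        qed (use x in \<open>auto simp: less_imp_le\<close>)
        also have "\<dots> = y / S * g (2 ^ N) * (\<Sum>i<N. \<rho> ^ (N - i))"
          by (simp only: x_def sum_distrib_left mult_ac)
        also have "\<dots> \<le> y / S * g (2 ^ N) * S"
          using S_ge y S g_pos[of "2 ^ N"] by (intro mult_left_mono) auto
        also have "\<dots> = y * g (2 ^ N)" using S by simp
        finally show False using \<omega>(3) by simp
      qed
      have PE: "prob (E i l) \<le> K * (C * S / y * \<rho> ^ (N - i)) ^ p" if "i < N" for i l
      proof -
        have "prob (E i l) \<le> K * (g (2 ^ i) / x i) ^ p"
          unfolding E_def using K(2)[of "n + l * 2 ^ i" "n + (l + 1) * 2 ^ i" "x i"] x by simp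
        also have "\<dots> \<le> K * (C * S / y * \<rho> ^ (N - i)) ^ p"
        proof (intro mult_left_mono power_mono)
          have "g (2 ^ i) / x i \<le> C * (\<rho>\<^sup>2) ^ (N - i) * g (2 ^ N) / x i"
            using growth[OF that] x[of i] by (intro divide_right_mono) auto
          also have "\<dots> = C * S / y * \<rho> ^ (N - i)"
            using y S \<rho> g_pos[of "2 ^ N"] by (simp add: x_def power2_eq_square power_mult_distrib)
          finally show "g (2 ^ i) / x i \<le> C * S / y * \<rho> ^ (N - i)" .
        qed (use K g_pos[of "2^i"] x[of i] in auto)
        finally show ?thesis .
      qed
      have "prob {\<omega> \<in> space M. \<exists>j<2 ^ N. \<bar>X (n + j) \<omega> - X n \<omega>\<bar> > y * g (2 ^ N)}
          \<le> prob (\<Union>i<N. \<Union>l<2 ^ (N - i). E i l)"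
        by (intro finite_measure_mono sub) auto
      also have "\<dots> \<le> (\<Sum>i<N. prob (\<Union>l<2 ^ (N - i). E i l))"
        by (intro finite_measure_subadditive_finite) auto
      also have "\<dots> \<le> (\<Sum>i<N. \<Sum>l<2 ^ (N - i). prob (E i l))"
        by (intro sum_mono finite_measure_subadditive_finite) auto
      also have "\<dots> \<le> (\<Sum>i<N. \<Sum>l<(2::nat) ^ (N - i). K * (C * S / y * \<rho> ^ (N - i)) ^ p)"
        using PE by (intro sum_mono) auto
      also have "\<dots> = (\<Sum>i<N. K * (C * S / y) ^ p * (2 * \<rho> ^ p) ^ (N - i))"
      proof -
        have e: "real (2 ^ k) * (K * (c * \<rho> ^ k) ^ p) = K * c ^ p * (2 * \<rho> ^ p) ^ k" for k c
          by (simp add: power_mult_distrib mult_ac flip: power_mult)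
        show ?thesis by (intro sum.cong refl) (simp only: sum_constant card_lessThan e)
      qed
      also have "\<dots> = K * (C * S / y) ^ p * (\<Sum>i<N. (2 * \<rho> ^ p) ^ (N - i))"
        by (simp add: sum_distrib_left)
      also have "\<dots> \<le> K * (C * S / y) ^ p * 1"
        using geo K C S y by (intro mult_left_mono) auto
      finally show ?thesis by (simp add: power_divide)
    qed
    then show "\<exists>K\<ge>0. \<forall>n N y. y > 0 \<longrightarrow>
        prob {\<omega> \<in> space M. \<exists>j<2 ^ N. \<bar>X (n + j) \<omega> - X n \<omega>\<bar> > y * g (2 ^ N)} \<le> K / y ^ p"
      using K C S by (intro exI[of _ "K * (C * S) ^ p"]) auto
  qed
qed

end

section \<open>Almost sure upper bound along a stretched exponential grid\<close>

lemma exp_grid_gap: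
  assumes b: "0 < b" "b < (1::real)"
  shows "\<forall>\<^sub>F k in sequentially. exp (real (Suc k) powr b) + 1 - exp (real k powr b)
    \<le> 4 * real k powr (b - 1) * exp (real k powr b)"
  using b by real_asymp

lemma ex_block_index:
  fixes f :: "nat \<Rightarrow> nat"
  assumes f: "incseq f" "filterlim f at_top sequentially" and n: "f k0 \<le> n"
  obtains k where "k0 \<le> k" "f k \<le> n" "n < f (Suc k)"
proof -
  have "\<forall>\<^sub>F k in sequentially. n < f k" 
    using f(2)[unfolded filterlim_at_top, rule_format, of "Suc n"] by (simp add: Suc_le_eq)
  then obtain k1 where k1: "n < f k1" by (auto simp: eventually_sequentially)
  define j where "j = (LEAST k. n < f k)"
  have j: "n < f j" unfolding j_def by (rule LeastI) (rule k1)
  have "k0 < j"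
    using j n incseqD[OF f(1), of j k0] by (meson not_le order_less_le_trans less_irrefl)
  then obtain k where k: "j = Suc k" "k0 \<le> k" by (cases j) auto
  have "\<not> n < f k" using not_less_Least[of k "\<lambda>k. n < f k"] k by (simp add: j_def)
  then show ?thesis using that[of k] k j by auto
qed

lemma (in finite_measure) AE_eventually_not:
  assumes m: "\<And>k::nat. {\<omega> \<in> space M. P k \<omega>} \<in> sets M" and s: "summable b"
    and le: "\<forall>\<^sub>F k in sequentially. measure M {\<omega> \<in> space M. P k \<omega>} \<le> b k"
  shows "AE \<omega> in M. \<forall>\<^sub>F k in sequentially. \<not> P k \<omega>"
proof -
  have "AE \<omega> in M. \<forall>\<^sub>F k in sequentially. \<omega> \<in> space M - {\<omega> \<in> space M. P k \<omega>}"
  proof (rule borel_cantelli_AE1)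
    show "summable (\<lambda>k. measure M {\<omega> \<in> space M. P k \<omega>})"
      by (rule summable_comparison_test_ev[OF _ s]) (use le in simp)
  qed (use m in \<open>auto simp: emeasure_eq_measure\<close>)
  then show ?thesis by (auto elim: eventually_mono)
qed

context lil_process
begin

lemma AE_upper:
  assumes \<epsilon>: "\<epsilon> > 0"
  shows "AE \<omega> in M. \<forall>\<^sub>F n in sequentially. X n \<omega> \<le> (1 + \<epsilon>) * (g n * llog n)"
proof -
  \<comment> \<open>The losses collected below multiply to \<open>(1 + 3 * e) * (1 + e)\<close>,
    which is at most \<open>1 + 8 * e\<close>.\<close>
  define e where "e = min \<epsilon> 1 / 8"
  have e: "0 < e" "e \<le> 1/8" "8 * e \<le> \<epsilon>" using \<epsilon> by (auto simp: e_def)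
  \<comment> \<open>Chosen so that \<open>\<beta> * (1 + e)^2 = 1 + e\<close> exceeds 1, although
    \<beta> < 1. In addition \<beta> \<ge> 1/2 makes the fourth power of
    \<open>k powr \<beta>\<close> at least \<open>k^2\<close>.\<close>
  define \<beta> where "\<beta> = 1 / (1 + e)"
  have \<beta>: "0 < \<beta>" "\<beta> < 1" "1/2 \<le> \<beta>" using e by (auto simp: \<beta>_def divide_simps)
  define N where "N k = nat \<lceil>exp (real k powr \<beta>)\<rceil>" for k
  have N_ge: "exp (real k powr \<beta>) \<le> real (N k)" for k
    unfolding N_def by (rule real_nat_ceiling_ge)
  have N_le: "real (N k) \<le> exp (real k powr \<beta>) + 1" for k
  proof -
    have "- 1 < exp (real k powr \<beta>)" using exp_gt_zero[of "real k powr \<beta>"] by linarith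
    then show ?thesis unfolding N_def by (subst of_nat_nat) (simp_all add: of_int_ceiling_le_add_one)
  qed
  have N1: "N k \<ge> 1" for k
  proof -
    have "0 < real (N k)" using N_ge[of k] by (rule order_less_le_trans[OF exp_gt_zero])
    then show ?thesis by simp
  qed
  have N_mono: "incseq N"
    unfolding incseq_def N_def
  proof (intro allI impI nat_mono ceiling_mono)
    fix m n :: nat assume "m \<le> n"
    then show "exp (real m powr \<beta>) \<le> exp (real n powr \<beta>)" using \<beta> by (simp add: powr_mono2)
  qed
  have lnN: "real k powr \<beta> \<le> ln (real (N k))" for k
    using N_ge[of k] N1[of k] by (subst ln_ge_iff) auto
  have rN_top: "filterlim (\<lambda>k. real (N k)) at_top sequentially"
  proof (rule filterlim_at_top_mono)
    show "filterlim (\<lambda>k. exp (real k powr \<beta>)) at_top sequentially" using \<beta> by real_asymp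
  qed (use N_ge in simp)
  then have N_top: "filterlim N at_top sequentially"
    by (simp add: filterlim_sequentially_iff_filterlim_real)
  \<comment> \<open>The gap follows the derivative of \<open>exp (x powr \<beta>)\<close>, namely
    \<open>\<beta> * x powr (\<beta> - 1) * exp (x powr \<beta>)\<close>. The summand 1 in the
    analytic estimate accounts for the ceiling, and the factor 4 is slack.\<close>
  have gap: "\<forall>\<^sub>F k in sequentially. real (N (Suc k) - N k) \<le> 4 * real k powr (\<beta> - 1) * real (N k)"
    using exp_grid_gap[OF \<beta>(1,2)]
  proof eventually_elim
    case (elim k)
    have "real (N (Suc k) - N k) = real (N (Suc k)) - real (N k)"
      using incseqD[OF N_mono, of k "Suc k"] by (simp add: of_nat_diff)
    also have "\<dots> \<le> exp (real (Suc k) powr \<beta>) + 1 - exp (real k powr \<beta>)"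
      using N_le[of "Suc k"] N_ge[of k] by linarith
    also have "\<dots> \<le> 4 * real k powr (\<beta> - 1) * exp (real k powr \<beta>)" by (rule elim)
    also have "\<dots> \<le> 4 * real k powr (\<beta> - 1) * real (N k)"
      using N_ge[of k] by (intro mult_left_mono) auto
    finally show ?case .
  qed
  have llog1: "\<forall>\<^sub>F k in sequentially. llog (N k) \<ge> 1"
    using filterlim_compose[OF llog_at_top N_top] by (simp add: filterlim_at_top)

  \<comment> \<open>Along the grid, the Wasserstein error \<open>1 / log (N k)\<close> becomes summable at order \<open>p = 4\<close>.\<close>
  have A: "AE \<omega> in M. \<forall>\<^sub>F k in sequentially.
      \<not> X (N k) \<omega> - X 0 \<omega> > ((1 + e) * llog (N k) + e * llog (N k)) * g (N k - 0)"
  proof -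
    obtain K where K: "K \<ge> 0" "\<And>m n x y. m < n \<Longrightarrow> x \<ge> 0 \<Longrightarrow> y > 0 \<Longrightarrow>
        prob {\<omega> \<in> space M. X n \<omega> - X m \<omega> > (x + y) * g (n - m)}
          \<le> exp (- x\<^sup>2 / 2) + K / (y * (1 + ln (real (n - m)))) ^ 4"
      using gaussian_tail[of 4] by auto
    show ?thesis
    proof (rule AE_eventually_not)
      show "summable (\<lambda>k. real k powr (- (1 + e)) + K / e ^ 4 * real k powr (- 2))"
        using e by (intro summable_add summable_mult) (simp_all add: summable_real_powr_iff)
      show "\<forall>\<^sub>F k in sequentially. prob {\<omega> \<in> space M. X (N k) \<omega> - X 0 \<omega> >
          ((1 + e) * llog (N k) + e * llog (N k)) * g (N k - 0)}
          \<le> real k powr (- (1 + e)) + K / e ^ 4 * real k powr (- 2)"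
        using llog1 eventually_ge_at_top[of 1]
      proof eventually_elim
        case (elim k)
        define z where "z = ln (real (N k))"
        have kb: "real k powr \<beta> > 0" using elim by simp
        have z: "real k powr \<beta> \<le> z" "z > 0" unfolding z_def using lnN[of k] kb by linarith+
        have zz: "(llog (N k))\<^sup>2 = 2 * ln z"
          using elim unfolding llog_def z_def by (intro real_sqrt_pow2) auto
        \<comment> \<open>Half the square of \<open>llog (N k)\<close> is \<open>ln z\<close>, so
          the Gaussian tail is a negative power of \<open>z = ln (N k)\<close>, and
          \<open>z \<ge> k powr \<beta>\<close> turns it into a summable power of
          \<open>k\<close>.\<close>
        have "exp (- ((1 + e) * llog (N k))\<^sup>2 / 2) = z powr (- (1 + e)\<^sup>2)"
          using z by (simp add: power_mult_distrib zz powr_def)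
        also have "\<dots> \<le> (real k powr \<beta>) powr (- (1 + e)\<^sup>2)"
          using z kb by (intro powr_mono2') auto
        also have "\<dots> = real k powr (- (1 + e))"
          using e by (simp add: powr_powr \<beta>_def power2_eq_square)
        finally have 1: "exp (- ((1 + e) * llog (N k))\<^sup>2 / 2) \<le> real k powr (- (1 + e))" .
        have "e ^ 4 * real k powr 2 \<le> e ^ 4 * real k powr (4 * \<beta>)"
          using elim \<beta> by (intro mult_left_mono powr_mono) auto
        also have "\<dots> = (e * real k powr \<beta>) ^ 4"
          using elim by (simp add: power_mult_distrib powr_powr mult.commute flip: powr_realpow)
        also have "\<dots> \<le> (e * llog (N k) * (1 + z)) ^ 4"
        proof (intro power_mono)
          have "e * 1 * (real k powr \<beta>) \<le> e * llog (N k) * (1 + z)"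
            using e elim z by (intro mult_mono) auto
          then show "e * real k powr \<beta> \<le> e * llog (N k) * (1 + z)" by simp
        qed (use e in auto)
        finally have "K / (e * llog (N k) * (1 + z)) ^ 4 \<le> K / (e ^ 4 * real k powr 2)"
          using K(1) e elim z by (intro divide_left_mono) (auto intro!: mult_pos_pos)
        also have "\<dots> = K / e ^ 4 * real k powr (- 2)" by (simp add: powr_minus divide_inverse)
        finally have 2: "K / (e * llog (N k) * (1 + z)) ^ 4 \<le> K / e ^ 4 * real k powr (- 2)" .
        show ?case
          using K(2)[of 0 "N k" "(1 + e) * llog (N k)" "e * llog (N k)"] N1[of k] e elim 1 2
          by (simp add: z_def)
      qed
    qed measurable
  qed

  have B: "AE \<omega> in M. \<forall>\<^sub>F k in sequentially.
      \<not> (\<exists>j<N (Suc k) - N k. \<bar>X (N k + j) \<omega> - X (N k) \<omega>\<bar> > e * g (N k))"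
  proof -
    obtain C b where C: "C > 0" "b > 0"
      "\<And>m n. 1 \<le> m \<Longrightarrow> m \<le> n \<Longrightarrow> g m \<le> C * (real m / real n) powr b * g n"
      using potter by blast
    obtain p0 where p0: "\<And>p. p \<ge> p0 \<Longrightarrow> \<exists>K\<ge>0. \<forall>n N y. y > 0 \<longrightarrow>
      prob {\<omega> \<in> space M. \<exists>j<2 ^ N. \<bar>X (n + j) \<omega> - X n \<omega>\<bar> > y * g (2 ^ N)} \<le> K / y ^ p"
      using maximal_inequality by blast
    \<comment> \<open>The relative gap is of order \<open>k powr (\<beta> - 1)\<close>; the Potter
      exponent \<open>b\<close> turns this into a relative fluctuation of order
      \<open>k powr (- c)\<close>. A moment of order \<open>p \<ge> 2 / c\<close> then gives the
      summable bound \<open>k powr (- 2)\<close>.\<close>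
    define c where "c = (1 - \<beta>) * b"
    have c: "c > 0" using \<beta> C by (simp add: c_def)
    obtain p1 :: nat where p1: "real p1 > 2 / c" using reals_Archimedean2 by blast
    define p where "p = max p0 p1"
    have pc: "c * real p \<ge> 2"
    proof -
      have "real p \<ge> 2 / c" using p1 by (simp add: p_def)
      then show ?thesis using c by (simp add: field_simps)
    qed
    obtain K where K: "K \<ge> 0" "\<And>n N y. y > 0 \<Longrightarrow>
      prob {\<omega> \<in> space M. \<exists>j<2 ^ N. \<bar>X (n + j) \<omega> - X n \<omega>\<bar> > y * g (2 ^ N)} \<le> K / y ^ p"
      using p0[of p] by (auto simp: p_def)
    \<comment> \<open>The 8 combines the factor 4 from the grid gap with the doubling when the gap
      is rounded up to the power of two \<open>2 ^ Suc l\<close>.\<close>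
    define D where "D = C * 8 powr b"
    have D: "D > 0" using C by (simp add: D_def)
    have small: "\<forall>\<^sub>F k in sequentially. 8 * real k powr (\<beta> - 1) \<le> 1"
      using \<beta> by real_asymp
    have big: "\<forall>\<^sub>F k in sequentially. 1 \<le> 4 * real k powr (\<beta> - 1) * exp (real k powr \<beta>)"
      using \<beta> by real_asymp
    show ?thesis
    proof (rule AE_eventually_not)
      show "summable (\<lambda>k. K * (D / e) ^ p * real k powr (- 2))"
        by (intro summable_mult) (simp add: summable_real_powr_iff)
      show "\<forall>\<^sub>F k in sequentially. prob {\<omega> \<in> space M.
          \<exists>j<N (Suc k) - N k. \<bar>X (N k + j) \<omega> - X (N k) \<omega>\<bar> > e * g (N k)}
          \<le> K * (D / e) ^ p * real k powr (- 2)"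
        using gap small big eventually_ge_at_top[of 1]
      proof eventually_elim
        case (elim k)
        \<comment> \<open>The maximum with 1 covers coinciding grid points, for which the gap has no
          binary logarithm.\<close>
        define G where "G = max 1 (N (Suc k) - N k)"
        obtain l where l: "2 ^ l \<le> G" "G < 2 ^ Suc l" by (rule ex_floor_log2[of G]) (auto simp: G_def)
        have "1 \<le> 4 * real k powr (\<beta> - 1) * real (N k)"
          using elim(3) mult_left_mono[OF N_ge[of k], of "4 * real k powr (\<beta> - 1)"] by simp
        then have G: "real G \<le> 4 * real k powr (\<beta> - 1) * real (N k)"
          using elim(1) by (simp add: G_def)
        have "real (2 ^ Suc l) = 2 * real (2 ^ l)" by simp
        also have "\<dots> \<le> 2 * real G" using l(1) by (intro mult_left_mono) (auto simp flip: of_nat_power)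
        also have "\<dots> \<le> 8 * real k powr (\<beta> - 1) * real (N k)" using G by (simp add: algebra_simps)
        finally have l8: "real (2 ^ Suc l) \<le> 8 * real k powr (\<beta> - 1) * real (N k)" .
        also have "\<dots> \<le> 1 * real (N k)" using elim(2) by (intro mult_right_mono) auto
        finally have lN: "2 ^ Suc l \<le> N k" by (simp only: mult_1 of_nat_le_iff)
        have "g (2 ^ Suc l) \<le> C * (real (2 ^ Suc l) / real (N k)) powr b * g (N k)"
          by (rule C(3)[OF _ lN]) simp
        also have "\<dots> \<le> C * (8 * real k powr (\<beta> - 1)) powr b * g (N k)"
        proof (intro mult_right_mono mult_left_mono powr_mono2)
          show "real (2 ^ Suc l) / real (N k) \<le> 8 * real k powr (\<beta> - 1)"
            using l8 N1[of k] by (simp add: divide_le_eq)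
        qed (use C g_pos[of "N k"] in auto)
        also have "(8 * real k powr (\<beta> - 1)) powr b = 8 powr b * real k powr (- c)"
          by (simp add: powr_mult powr_powr c_def algebra_simps)
        finally have gl: "g (2 ^ Suc l) \<le> D * real k powr (- c) * g (N k)" by (simp add: D_def mult_ac)
        \<comment> \<open>The largest level for which the bound on \<open>g (2 ^ Suc l)\<close>
          still guarantees \<open>y * g (2 ^ Suc l) \<le> e * g (N k)\<close>.\<close>
        define y where "y = e * real k powr c / D"
        have y: "y > 0" using e D elim by (simp add: y_def)
        have "y * g (2 ^ Suc l) \<le> y * (D * real k powr (- c) * g (N k))"
          using gl y by (intro mult_left_mono) auto
        also have "\<dots> = e * g (N k)" using D elim(4)
          by (simp add: y_def powr_minus)
        finally have yg: "y * g (2 ^ Suc l) \<le> e * g (N k)" .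
        have "prob {\<omega> \<in> space M. \<exists>j<N (Suc k) - N k. \<bar>X (N k + j) \<omega> - X (N k) \<omega>\<bar> > e * g (N k)}
          \<le> prob {\<omega> \<in> space M. \<exists>j<2 ^ Suc l. \<bar>X (N k + j) \<omega> - X (N k) \<omega>\<bar> > y * g (2 ^ Suc l)}"
        proof (intro finite_measure_mono subsetI)
          fix \<omega> assume "\<omega> \<in> {\<omega> \<in> space M. \<exists>j<N (Suc k) - N k. \<bar>X (N k + j) \<omega> - X (N k) \<omega>\<bar> > e * g (N k)}"
          then obtain j where "\<omega> \<in> space M" "j < N (Suc k) - N k" "\<bar>X (N k + j) \<omega> - X (N k) \<omega>\<bar> > e * g (N k)"
            by auto
          moreover from this have "j < 2 ^ Suc l" using l(2) by (simp only: G_def)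
          ultimately show "\<omega> \<in> {\<omega> \<in> space M. \<exists>j<2 ^ Suc l. \<bar>X (N k + j) \<omega> - X (N k) \<omega>\<bar> > y * g (2 ^ Suc l)}"
            using yg by (auto intro!: exI[of _ j] simp del: power_Suc)
        qed measurable
        also have "\<dots> \<le> K / y ^ p" by (rule K(2)[OF y])
        also have "\<dots> = K * (D / e) ^ p * real k powr (- (c * real p))"
        proof -
          have yp: "y ^ p = (e / D) ^ p * real k powr (c * real p)"
            using elim(4) by (simp add: y_def power_divide power_mult_distrib powr_powr flip: powr_realpow)
          show ?thesis unfolding yp using D e elim(4) by (simp add: powr_minus power_divide divide_simps)
        qed
        also have "\<dots> \<le> K * (D / e) ^ p * real k powr (- 2)"
          using elim(4) pc K(1) D e by (intro mult_left_mono powr_mono) auto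
        finally show ?case .
      qed
    qed measurable
  qed

  obtain \<delta> where \<delta>: "\<delta> > 0"
    "\<forall>\<^sub>F n in sequentially. \<forall>m\<le>n. real (n - m) \<le> \<delta> * real n \<longrightarrow> \<bar>g m - g n\<bar> \<le> e * g n"
    using g_near[OF e(1)] by blast
  then obtain n1 where n1: "\<And>n m. n \<ge> n1 \<Longrightarrow> m \<le> n \<Longrightarrow> real (n - m) \<le> \<delta> * real n \<Longrightarrow> \<bar>g m - g n\<bar> \<le> e * g n"
    unfolding eventually_sequentially by blast
  have gd: "\<forall>\<^sub>F k in sequentially. 4 * real k powr (\<beta> - 1) \<le> \<delta>"
    using \<beta> \<delta>(1) by real_asymp
  have Nn1: "\<forall>\<^sub>F k in sequentially. N k \<ge> max 2 n1"
    using N_top by (simp only: filterlim_at_top)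
  show ?thesis
    using A B AE_space
  proof eventually_elim
    case (elim \<omega>)
    from elim(1,2) gap gd Nn1 llog1
    have "\<forall>\<^sub>F k in sequentially. \<forall>n. N k \<le> n \<longrightarrow> n < N (Suc k) \<longrightarrow> X n \<omega> \<le> (1 + \<epsilon>) * (g n * llog n)"
    proof eventually_elim
      case k: (elim k)
      show ?case
      proof (intro allI impI)
        fix n assume n: "N k \<le> n" "n < N (Suc k)"
        have "n - N k < N (Suc k) - N k" using n by simp
        then have "\<not> \<bar>X (N k + (n - N k)) \<omega> - X (N k) \<omega>\<bar> > e * g (N k)" using k(2) by blast
        then have 1: "X n \<omega> \<le> X (N k) \<omega> + e * g (N k)" using n by simp
        have 2: "X (N k) \<omega> \<le> (1 + 2 * e) * llog (N k) * g (N k)"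
          using k(1) X0[OF elim(3)] by (simp add: algebra_simps)
        have 3: "e * g (N k) \<le> e * llog (N k) * g (N k)"
          using k(6) e g_pos[of "N k"] by (simp add: mult_le_cancel_right1)
        have "real (n - N k) \<le> real (N (Suc k) - N k)" using n by simp
        also have "\<dots> \<le> \<delta> * real (N k)" using k(3) mult_right_mono[OF k(4), of "real (N k)"] by simp
        also have "\<dots> \<le> \<delta> * real n" using n \<delta>(1) by simp
        finally have "\<bar>g (N k) - g n\<bar> \<le> e * g n" using n1[of n "N k"] k(5) n by simp
        then have 4: "g (N k) \<le> (1 + e) * g n" by (simp add: algebra_simps)
        have 5: "llog (N k) \<le> llog n" using k(5) n by (intro llog_mono) auto
        \<comment> \<open>The budget: \<open>1 + 2 * e\<close> at the grid point and
          \<open>e\<close> for the fluctuation, expressed through \<open>llog (N k) \<ge> 1\<close>.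
          A factor \<open>1 + e\<close> for passing from \<open>g (N k)\<close> to
          \<open>g n\<close> follows.\<close>
        have "X n \<omega> \<le> (1 + 3 * e) * (llog (N k) * g (N k))"
          using 1 2 3 by (simp add: algebra_simps)
        also have "\<dots> \<le> (1 + 3 * e) * (llog n * ((1 + e) * g n))"
          using 4 5 e k(6) g_pos[of "N k"] by (intro mult_left_mono mult_mono) auto
        also have "\<dots> = ((1 + 3 * e) * (1 + e)) * (g n * llog n)" by simp
        also have "\<dots> \<le> (1 + \<epsilon>) * (g n * llog n)"
        proof (rule mult_right_mono)
          have "e * e \<le> e * 1" using e by (intro mult_left_mono) auto
          then have "(1 + 3 * e) * (1 + e) \<le> 1 + 8 * e" using e by (simp add: algebra_simps)
          then show "(1 + 3 * e) * (1 + e) \<le> 1 + \<epsilon>" using e(3) by linarith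
          show "0 \<le> g n * llog n" using g_pos[of n] 5 k(6) by auto
        qed
        finally show "X n \<omega> \<le> (1 + \<epsilon>) * (g n * llog n)" .
      qed
    qed
    then obtain k0 where k0: "\<And>k n. k \<ge> k0 \<Longrightarrow> N k \<le> n \<Longrightarrow> n < N (Suc k) \<Longrightarrow> X n \<omega> \<le> (1 + \<epsilon>) * (g n * llog n)"
      unfolding eventually_sequentially by blast
    have "X n \<omega> \<le> (1 + \<epsilon>) * (g n * llog n)" if "n \<ge> N k0" for n
      by (rule ex_block_index[OF N_mono N_top that]) (rule k0)
    then show ?case unfolding eventually_sequentially by blast
  qed
qed

end

subsection \<open>The lower bound\<close>

text \<open>The exponent \<open>1 + e\<close> exceeds 1, so its increments from \<open>k\<close> to
  \<open>Suc k\<close> tend to infinity. The 1 subtracted in the denominator leaves room for the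
  floor in the grid.\<close>

lemma exp_grid_ratio:
  assumes "c > (0::real)" "e > (0::real)"
  shows "(\<lambda>k. exp (c * real k powr (1 + e)) / (exp (c * real (Suc k) powr (1 + e)) - 1)) \<longlonglongrightarrow> 0"
  using assms by real_asymp

text \<open>Once consecutive values have ratio below 1/2, the gap exceeds the lower value. Taking
  logarithms bounds the denominator in (A4) from below by a power of \<open>m\<close> with exponent
  larger than 1.\<close>

lemma exp_grid_diff:
  assumes c: "c > (0::real)" "e > (0::real)"
  shows "\<forall>\<^sub>F m in sequentially. exp (c * real m powr (1 + e))
    \<le> exp (c * real (m + 2) powr (1 + e)) - 1 - exp (c * real (m + 1) powr (1 + e))"
proof -
  have "\<forall>\<^sub>F k in sequentially. exp (c * real k powr (1 + e)) / (exp (c * real (Suc k) powr (1 + e)) - 1) < 1/2"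
    by (rule order_tendstoD(2)[OF exp_grid_ratio[OF c]]) simp
  then have "\<forall>\<^sub>F k in sequentially. exp (c * real (Suc k) powr (1 + e)) / (exp (c * real (Suc (Suc k)) powr (1 + e)) - 1) < 1/2"
    by (rule eventually_compose_filterlim[OF _ filterlim_Suc])
  then show ?thesis
  proof eventually_elim
    case (elim k)
    have "exp (c * real (Suc (Suc k)) powr (1 + e)) - 1 > 0" using c by simp
    then have "2 * exp (c * real (Suc k) powr (1 + e)) < exp (c * real (Suc (Suc k)) powr (1 + e)) - 1"
      using elim by (simp add: divide_less_eq)
    moreover have "exp (c * real k powr (1 + e)) \<le> exp (c * real (Suc k) powr (1 + e))"
      using c by (simp add: powr_mono2)
    ultimately have "exp (c * real k powr (1 + e)) \<le> exp (c * real (Suc (Suc k)) powr (1 + e)) - 1 - exp (c * real (Suc k) powr (1 + e))"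
      by linarith
    then show ?case by (simp only: add_2_eq_Suc' Suc_eq_plus1[symmetric])
  qed
qed

text \<open>A block has \<open>m\<close> Gaussian trials, each successful with probability at least
  of order \<open>m powr (- (1 - e^2)^2)\<close>. As this exponent has modulus below 1, the expected
  number of hits diverges.\<close>

lemma block_hits_at_top:
  assumes e: "0 < (e::real)" "e < 1"
  shows "filterlim (\<lambda>m. real m * exp (- (1 - e\<^sup>2)\<^sup>2 * ln (3 * real m) - C)) at_top sequentially"
proof -
  have "e\<^sup>2 < 1" using e by (simp add: power_less_one_iff)
  then have "(1 - e\<^sup>2)\<^sup>2 < 1" using e by (intro power_less_one_iff[THEN iffD2]) auto
  then show ?thesis by real_asymp
qed

lemma (in lil_process) AE_lower:
  assumes \<epsilon>: "0 < \<epsilon>" "\<epsilon> < 1"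
    and neg: "AE \<omega> in M. \<forall>\<^sub>F n in sequentially. - X n \<omega> \<le> 2 * (g n * llog n)"
  shows "AE \<omega> in M. \<exists>\<^sub>F n in sequentially. X n \<omega> \<ge> (1 - 4 * \<epsilon>) * (g n * llog n)"
proof -
  obtain c where c: "c > 0" and c': "\<And>\<alpha>. \<alpha> > 0 \<Longrightarrow> \<exists>C\<ge>0. \<forall>m t. m \<ge> 1 \<longrightarrow> t \<ge> 0 \<longrightarrow>
        (let N = (\<lambda>i::nat. nat \<lfloor>exp (c * real i powr (1 + \<alpha>))\<rfloor>)
         in prob {\<omega> \<in> space M. \<forall>j<m. X (N (m + 2 * j + 2)) \<omega> - X (N (m + 2 * j + 1)) \<omega>
                    \<le> t * g (N (m + 2 * j + 2) - N (m + 2 * j + 1))}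
            \<le> (1 - exp (- (t + 2)\<^sup>2 / 2) / 3) ^ m
              + real m * C / (1 + ln (real (N (m + 2) - N (m + 1)))))"
    using block by blast
  \<comment> \<open>The grid parameter of (A4) is tied to \<epsilon>:
    \<open>ln (ln (N (3 * m)))\<close> grows at most like \<open>(1 + \<epsilon>) * ln m\<close>, a
    loss that the factor \<open>1 - \<epsilon>\<close> in the threshold outweighs.\<close>
  define N where "N i = nat \<lfloor>exp (c * real i powr (1 + \<epsilon>))\<rfloor>" for i
  obtain C where C: "C \<ge> 0" and blk: "\<And>m t. m \<ge> 1 \<Longrightarrow> t \<ge> 0 \<Longrightarrow>
        prob {\<omega> \<in> space M. \<forall>j<m. X (N (m + 2 * j + 2)) \<omega> - X (N (m + 2 * j + 1)) \<omega>
                    \<le> t * g (N (m + 2 * j + 2) - N (m + 2 * j + 1))}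
            \<le> (1 - exp (- (t + 2)\<^sup>2 / 2) / 3) ^ m
              + real m * C / (1 + ln (real (N (m + 2) - N (m + 1))))"
    using c'[OF \<epsilon>(1)] unfolding Let_def N_def by blast
  have N_le: "real (N k) \<le> exp (c * real k powr (1 + \<epsilon>))" for k
    unfolding N_def by (rule of_nat_floor) simp
  have N_ge: "exp (c * real k powr (1 + \<epsilon>)) - 1 \<le> real (N k)" for k
    unfolding N_def by (subst of_nat_nat) (simp, linarith)
  have N_mono: "incseq N"
    unfolding incseq_def N_def
  proof (intro allI impI nat_mono floor_mono)
    fix m n :: nat assume "m \<le> n"
    then show "exp (c * real m powr (1 + \<epsilon>)) \<le> exp (c * real n powr (1 + \<epsilon>))"
      using \<epsilon> c by (simp add: powr_mono2)
  qed
  have "filterlim (\<lambda>k. real (N k)) at_top sequentially"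
  proof (rule filterlim_at_top_mono)
    show "filterlim (\<lambda>k. exp (c * real k powr (1 + \<epsilon>)) - 1) at_top sequentially"
      using \<epsilon> c by real_asymp
  qed (use N_ge in simp)
  then have N_top: "filterlim N at_top sequentially"
    by (simp add: filterlim_sequentially_iff_filterlim_real)
  have NS_top: "filterlim (\<lambda>k. N (Suc k)) at_top sequentially"
    using N_top by (simp add: filterlim_sequentially_Suc)
  have ratio: "(\<lambda>k. real (N k) / real (N (Suc k))) \<longlonglongrightarrow> 0"
  proof (rule Lim_null_comparison[OF always_eventually exp_grid_ratio[OF c \<epsilon>(1)]], rule allI)
    fix k
    have "exp (c * real (Suc k) powr (1 + \<epsilon>)) - 1 > 0" using c by simp
    then show "norm (real (N k) / real (N (Suc k)))
        \<le> exp (c * real k powr (1 + \<epsilon>)) / (exp (c * real (Suc k) powr (1 + \<epsilon>)) - 1)"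
      using N_le[of k] N_ge[of "Suc k"] by (auto intro!: frac_le)
  qed
  have gapln: "\<forall>\<^sub>F m in sequentially. c * real m powr (1 + \<epsilon>) \<le> ln (real (N (m + 2) - N (m + 1)))"
    using exp_grid_diff[OF c \<epsilon>(1)]
  proof eventually_elim
    case (elim m)
    have "N (m + 1) \<le> N (m + 2)" by (rule incseqD[OF N_mono]) simp
    then have "real (N (m + 2) - N (m + 1)) = real (N (m + 2)) - real (N (m + 1))"
      by (rule of_nat_diff)
    then have "exp (c * real m powr (1 + \<epsilon>)) \<le> real (N (m + 2) - N (m + 1))"
      using elim N_ge[of "m + 2"] N_le[of "m + 1"] by linarith
    then show ?case by (metis exp_gt_zero ln_exp ln_le_cancel_iff order_less_le_trans)
  qed

  \<comment> \<open>The largest index in the block is \<open>3 * m\<close>, reached for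
    \<open>j = m - 1\<close>. Taking \<open>llog\<close> there gives one threshold that dominates
    those of all coordinates.\<close>
  define T where "T m = (1 - \<epsilon>) * llog (N (3 * m))" for m
  define E where "E m = {\<omega> \<in> space M. \<forall>j<m. X (N (m + 2 * j + 2)) \<omega> - X (N (m + 2 * j + 1)) \<omega>
                    \<le> T m * g (N (m + 2 * j + 2) - N (m + 2 * j + 1))}" for m
  have [measurable]: "E m \<in> sets M" for m unfolding E_def by measurable
  have mult3: "filterlim (\<lambda>m::nat. 3 * m) at_top sequentially"
    by (rule filterlim_subseq) (simp add: strict_mono_def)
  have N3_top: "filterlim (\<lambda>m. N (3 * m)) at_top sequentially"
    by (rule filterlim_compose[OF N_top mult3])
  have llog3: "\<forall>\<^sub>F m in sequentially. llog (N (3 * m)) \<ge> 1"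
    using filterlim_compose[OF llog_at_top N3_top] by (simp add: filterlim_at_top)
  have E_lim: "(\<lambda>m. prob (E m)) \<longlonglongrightarrow> 0"
  proof -
    \<comment> \<open>Collects the terms independent of \<open>m\<close>: \<open>ln c\<close> from
      the grid and \<open>2 * (1 + 1 / \<epsilon>)\<close> from removing the shift in
      \<open>T m + 2\<close>.\<close>
    define D where "D = (1 + \<epsilon>) * (1 - \<epsilon>)\<^sup>2 * ln c + 2 * (1 + 1 / \<epsilon>)"
    define h where "h m = real m * exp (- (1 - \<epsilon>\<^sup>2)\<^sup>2 * ln (3 * real m) - D)" for m :: nat
    have h_top: "filterlim h at_top sequentially"
      unfolding h_def by (rule block_hits_at_top[OF \<epsilon>])
    show ?thesis
    proof (rule Lim_null_comparison)
      show "(\<lambda>m. exp (- (h m / 3)) + real m * C / (c * real m powr (1 + \<epsilon>))) \<longlonglongrightarrow> 0"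
      proof -
        have "(\<lambda>m. real m * C / (c * real m powr (1 + \<epsilon>))) \<longlonglongrightarrow> 0"
          using c \<epsilon> by real_asymp
        moreover have "(\<lambda>m. exp (- (h m / 3))) \<longlonglongrightarrow> 0"
        proof -
          have "filterlim (\<lambda>x::real. exp (- (x / 3))) (nhds 0) at_top" by real_asymp
          then show ?thesis using h_top by (rule filterlim_compose)
        qed
        ultimately show ?thesis using tendsto_add by fastforce
      qed
      show "\<forall>\<^sub>F m in sequentially. norm (prob (E m))
          \<le> exp (- (h m / 3)) + real m * C / (c * real m powr (1 + \<epsilon>))"
        using gapln llog3 eventually_ge_at_top[of 1]
      proof eventually_elim
        case (elim m)
        define u where "u = exp (- (T m + 2)\<^sup>2 / 2)"
        have T0: "T m \<ge> 0" using elim(2) \<epsilon> by (simp add: T_def)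
        have "prob (E m) \<le> (1 - u / 3) ^ m + real m * C / (1 + ln (real (N (m + 2) - N (m + 1))))"
          unfolding E_def u_def by (rule blk[OF elim(3) T0])
        also have "(1 - u / 3) ^ m \<le> exp (- (h m / 3))"
        proof -
          have "u \<le> 1" by (simp add: u_def)
          then have "(1 - u / 3) ^ m \<le> exp (- (u / 3)) ^ m"
            using exp_ge_add_one_self[of "- (u / 3)"] by (intro power_mono) auto
          also have "\<dots> = exp (- (real m * u / 3))" by (simp flip: exp_of_nat_mult)
          also have "\<dots> \<le> exp (- (h m / 3))"
          proof -
            define z where "z = ln (real (N (3 * m)))"
            have lz: "ln z \<ge> 1/2" "(llog (N (3 * m)))\<^sup>2 = 2 * ln z"
            proof -
              have "1 \<le> (llog (N (3 * m)))\<^sup>2" using elim(2) by (simp add: one_le_power)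
              moreover show *: "(llog (N (3 * m)))\<^sup>2 = 2 * ln z"
                using elim(2) unfolding llog_def z_def by (intro real_sqrt_pow2) auto
              ultimately show "ln z \<ge> 1/2" by simp
            qed
            have "z \<noteq> 0" using lz by auto
            have "real (N (3 * m)) > 0" using \<open>z \<noteq> 0\<close> by (cases "N (3 * m) = 0") (auto simp: z_def)
            then have "z \<le> ln (exp (c * real (3 * m) powr (1 + \<epsilon>)))"
              unfolding z_def using N_le[of "3 * m"] by (subst ln_le_cancel_iff) auto
            then have "z \<le> c * real (3 * m) powr (1 + \<epsilon>)" by simp
            moreover have "z > 0"
            proof -
              have "z \<ge> 0" using \<open>real (N (3 * m)) > 0\<close> by (simp add: z_def)
              then show ?thesis using \<open>z \<noteq> 0\<close> by simp
            qed
            ultimately have "ln z \<le> ln (c * real (3 * m) powr (1 + \<epsilon>))"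
              by (subst ln_le_cancel_iff) auto
            also have "\<dots> = ln c + (1 + \<epsilon>) * ln (3 * real m)"
              using c elim(3) by (simp add: ln_mult ln_powr)
            finally have lnz: "ln z \<le> ln c + (1 + \<epsilon>) * ln (3 * real m)" .
            \<comment> \<open>Young's inequality
              \<open>4 * T m \<le> \<epsilon> * (T m)^2 + 4 / \<epsilon>\<close> trades the shift by
              2 for one more factor \<open>1 + \<epsilon>\<close>. With the one from the grid, the
              exponent becomes \<open>(1 + \<epsilon>)^2 * (1 - \<epsilon>)^2 = (1 -
              \<epsilon>^2)^2\<close>.\<close>
            have "(T m + 2)\<^sup>2 \<le> (1 + \<epsilon>) * (T m)\<^sup>2 + (1 + 1 / \<epsilon>) * 4"
            proof -
              have "0 \<le> (\<epsilon> * T m - 2)\<^sup>2 / \<epsilon>" using \<epsilon> by simp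
              also have "\<dots> = \<epsilon> * (T m)\<^sup>2 - 4 * T m + 4 / \<epsilon>"
                using \<epsilon> by (simp add: power2_eq_square field_simps)
              finally show ?thesis using \<epsilon> by (simp add: power2_sum algebra_simps)
            qed
            then have "(T m + 2)\<^sup>2 / 2 \<le> (1 + \<epsilon>) * (1 - \<epsilon>)\<^sup>2 * ln z + 2 * (1 + 1 / \<epsilon>)"
              unfolding T_def power_mult_distrib lz(2) by (simp add: algebra_simps)
            also have "\<dots> \<le> (1 + \<epsilon>) * (1 - \<epsilon>)\<^sup>2 * (ln c + (1 + \<epsilon>) * ln (3 * real m)) + 2 * (1 + 1 / \<epsilon>)"
              using lnz \<epsilon> by (intro add_right_mono mult_left_mono) auto
            also have "\<dots> = (1 - \<epsilon>\<^sup>2)\<^sup>2 * ln (3 * real m) + D"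
            proof -
              have "(1 - \<epsilon>\<^sup>2)\<^sup>2 = (1 + \<epsilon>) * (1 - \<epsilon>)\<^sup>2 * (1 + \<epsilon>)"
                by (simp add: power2_eq_square algebra_simps)
              moreover have "w * (x + s * l) + y = w * s * l + (w * x + y)" for w x s l y :: real
                by (simp add: algebra_simps)
              ultimately show ?thesis by (simp only: D_def)
            qed
            finally have "exp (- (1 - \<epsilon>\<^sup>2)\<^sup>2 * ln (3 * real m) - D) \<le> u" by (simp add: u_def)
            then show ?thesis by (simp add: h_def mult_left_mono)
          qed
          finally show ?thesis .
        qed
        also have "real m * C / (1 + ln (real (N (m + 2) - N (m + 1)))) \<le> real m * C / (c * real m powr (1 + \<epsilon>))"
        proof (rule divide_left_mono)
          have "c * real m powr (1 + \<epsilon>) > 0" using c elim(3) by simp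
          moreover show "c * real m powr (1 + \<epsilon>) \<le> 1 + ln (real (N (m + 2) - N (m + 1)))" using elim(1) by simp
          ultimately show "0 < (1 + ln (real (N (m + 2) - N (m + 1)))) * (c * real m powr (1 + \<epsilon>))"
            by (metis mult_pos_pos order_less_le_trans)
          show "0 \<le> real m * C" using C by simp
        qed
        finally show ?case by simp
      qed
    qed
  qed

  define Q where "Q k \<omega> \<longleftrightarrow> X (N (Suc k)) \<omega> - X (N k) \<omega>
      > (1 - \<epsilon>) * llog (N (Suc k)) * g (N (Suc k) - N k)" for k \<omega>
  have N2: "\<forall>\<^sub>F k in sequentially. N k \<ge> 2" using N_top by (simp only: filterlim_at_top)
  \<comment> \<open>The event of no hit from \<open>m0\<close> on does not depend on
    \<open>m\<close>, yet it lies in \<open>E m\<close> for all large \<open>m\<close>; its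
    probability is thus at most the limit 0.\<close>
  have "AE \<omega> in M. \<exists>k\<ge>m0. Q k \<omega>" for m0
  proof -
    have [measurable]: "{\<omega> \<in> space M. \<not> (\<exists>k\<ge>m0. Q k \<omega>)} \<in> sets M" unfolding Q_def by measurable
    have "\<forall>\<^sub>F m in sequentially. prob {\<omega> \<in> space M. \<not> (\<exists>k\<ge>m0. Q k \<omega>)} \<le> prob (E m)"
      using N2 eventually_ge_at_top[of m0]
    proof eventually_elim
      case (elim m)
      show ?case
      proof (intro finite_measure_mono subsetI)
        fix \<omega> assume \<omega>: "\<omega> \<in> {\<omega> \<in> space M. \<not> (\<exists>k\<ge>m0. Q k \<omega>)}"
        have "X (N (m + 2 * j + 2)) \<omega> - X (N (m + 2 * j + 1)) \<omega>
                    \<le> T m * g (N (m + 2 * j + 2) - N (m + 2 * j + 1))" if "j < m" for j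
        proof -
          have "\<not> Q (m + 2 * j + 1) \<omega>" using \<omega> elim by auto
          then have "X (N (m + 2 * j + 2)) \<omega> - X (N (m + 2 * j + 1)) \<omega>
            \<le> (1 - \<epsilon>) * llog (N (m + 2 * j + 2)) * g (N (m + 2 * j + 2) - N (m + 2 * j + 1))"
            by (simp add: Q_def)
          also have "\<dots> \<le> T m * g (N (m + 2 * j + 2) - N (m + 2 * j + 1))"
          proof (unfold T_def, intro mult_right_mono mult_left_mono llog_mono)
            show "2 \<le> N (m + 2 * j + 2)"
              using elim(1) incseqD[OF N_mono, of m "m + 2 * j + 2"] by simp
            show "N (m + 2 * j + 2) \<le> N (3 * m)" using that by (intro incseqD[OF N_mono]) simp
          qed (use \<epsilon> g_pos in \<open>auto simp: less_imp_le\<close>)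
          finally show ?thesis .
        qed
        then show "\<omega> \<in> E m" using \<omega> by (simp add: E_def)
      qed measurable
    qed
    then have le0: "prob {\<omega> \<in> space M. \<not> (\<exists>k\<ge>m0. Q k \<omega>)} \<le> 0"
      by (intro tendsto_lowerbound[OF E_lim]) auto
    have "emeasure M {\<omega> \<in> space M. \<not> (\<exists>k\<ge>m0. Q k \<omega>)} = 0"
      unfolding emeasure_eq_measure antisym[OF le0 measure_nonneg] by (rule ennreal_0)
    moreover have "{\<omega> \<in> space M. \<not> (\<exists>k\<ge>m0. Q k \<omega>)} \<in> sets M" by fact
    ultimately show ?thesis by (rule AE_I[OF subset_refl])
  qed
  then have freq: "AE \<omega> in M. \<exists>\<^sub>F k in sequentially. Q k \<omega>"
    unfolding frequently_sequentially by (simp add: AE_all_countable)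

  obtain C b where Cb: "C > 0" "b > 0"
    "\<And>m n. 1 \<le> m \<Longrightarrow> m \<le> n \<Longrightarrow> g m \<le> C * (real m / real n) powr b * g n"
    using potter by blast
  obtain \<delta> where \<delta>: "\<delta> > 0"
    "\<forall>\<^sub>F n in sequentially. \<forall>m\<le>n. real (n - m) \<le> \<delta> * real n \<longrightarrow> \<bar>g m - g n\<bar> \<le> \<epsilon> * g n"
    using g_near[OF \<epsilon>(1)] by blast
  have ev1: "\<forall>\<^sub>F k in sequentially. \<forall>m\<le>N (Suc k). real (N (Suc k) - m) \<le> \<delta> * real (N (Suc k))
      \<longrightarrow> \<bar>g m - g (N (Suc k))\<bar> \<le> \<epsilon> * g (N (Suc k))"
    by (rule eventually_compose_filterlim[OF \<delta>(2) NS_top])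
  have ev2: "\<forall>\<^sub>F k in sequentially. real (N k) / real (N (Suc k)) < min \<delta> ((\<epsilon> / C) powr (1 / b))"
    using \<delta>(1) Cb \<epsilon> by (intro order_tendstoD(2)[OF ratio]) auto
  have ev3: "\<forall>\<^sub>F k in sequentially. llog (N k) \<ge> 1"
    using filterlim_compose[OF llog_at_top N_top] by (simp add: filterlim_at_top)
  show ?thesis using freq neg
  proof eventually_elim
    case (elim \<omega>)
    have "\<forall>\<^sub>F k in sequentially. - X (N k) \<omega> \<le> 2 * (g (N k) * llog (N k))"
      by (rule eventually_compose_filterlim[OF elim(2) N_top])
    with ev1 ev2 ev3 N2
    have "\<forall>\<^sub>F k in sequentially. Q k \<omega> \<longrightarrow>
        X (N (Suc k)) \<omega> \<ge> (1 - 4 * \<epsilon>) * (g (N (Suc k)) * llog (N (Suc k)))"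
    proof eventually_elim
      case k: (elim k)
      show ?case
      proof
        assume Q: "Q k \<omega>"
        define n n' where "n = N (Suc k)" and "n' = N k"
        have nn: "n' \<le> n" "n' \<ge> 2" using incseqD[OF N_mono, of k "Suc k"] k(4) by (auto simp: n_def n'_def)
        have ll: "1 \<le> llog n'" "llog n' \<le> llog n" using k(3) llog_mono[OF nn(2,1)] by (auto simp: n'_def)
        have rat: "real n' / real n < \<delta>" "real n' / real n < (\<epsilon> / C) powr (1 / b)"
          using k(2) by (auto simp: n_def n'_def)
        \<comment> \<open>The closeness of \<open>g\<close> is applied at \<open>n - n'\<close>,
          whose distance from \<open>n\<close> is \<open>n'\<close>, a vanishing fraction of
          \<open>n\<close>.\<close>
        have "real (n - (n - n')) \<le> \<delta> * real n"
          using rat(1) nn by (simp add: divide_less_eq split: if_splits)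
        then have "\<bar>g (n - n') - g n\<bar> \<le> \<epsilon> * g n"
          using k(1) by (simp add: n_def)
        then have g1: "(1 - \<epsilon>) * g n \<le> g (n - n')" by (simp add: algebra_simps)
        have "g n' \<le> C * (real n' / real n) powr b * g n" using Cb(3)[of n' n] nn by simp
        also have "\<dots> \<le> C * (\<epsilon> / C) * g n"
        proof (intro mult_right_mono mult_left_mono)
          have "(real n' / real n) powr b \<le> ((\<epsilon> / C) powr (1 / b)) powr b"
            using rat(2) Cb by (intro powr_mono2) auto
          also have "\<dots> = \<epsilon> / C" using Cb \<epsilon> by (simp add: powr_powr)
          finally show "(real n' / real n) powr b \<le> \<epsilon> / C" .
        qed (use Cb g_pos[of n] in auto)
        also have "\<dots> = \<epsilon> * g n" using Cb by simp
        finally have "g n' * llog n' \<le> (\<epsilon> * g n) * llog n"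
          using ll \<epsilon> g_pos[of n] by (intro mult_mono) auto
        moreover have "- X n' \<omega> \<le> 2 * (g n' * llog n')" using k(5) by (simp add: n'_def)
        moreover have "X n \<omega> - X n' \<omega> > (1 - \<epsilon>) * llog n * g (n - n')"
          using Q by (simp add: Q_def n_def n'_def)
        moreover have "(1 - \<epsilon>) * llog n * ((1 - \<epsilon>) * g n) \<le> (1 - \<epsilon>) * llog n * g (n - n')"
          using g1 ll \<epsilon> by (intro mult_left_mono) auto
        \<comment> \<open>One factor \<open>1 - \<epsilon>\<close> is from the threshold, one from
          replacing \<open>g (n - n')\<close> by \<open>g n\<close>, and
          \<open>2 * \<epsilon>\<close> is lost to the value at \<open>n'\<close>; the total is
          \<open>1 - 4 * \<epsilon> + \<epsilon>^2\<close>.\<close>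
        ultimately have "X n \<omega> \<ge> (1 - \<epsilon>) * llog n * ((1 - \<epsilon>) * g n) - 2 * ((\<epsilon> * g n) * llog n)"
          by linarith
        also have "(1 - \<epsilon>) * llog n * ((1 - \<epsilon>) * g n) - 2 * ((\<epsilon> * g n) * llog n)
          = (1 - 4 * \<epsilon> + \<epsilon>\<^sup>2) * (g n * llog n)"
          by (simp add: algebra_simps power2_eq_square)
        finally have "(1 - 4 * \<epsilon> + \<epsilon>\<^sup>2) * (g n * llog n) \<le> X n \<omega>" .
        moreover have "(1 - 4 * \<epsilon>) * (g n * llog n) \<le> (1 - 4 * \<epsilon> + \<epsilon>\<^sup>2) * (g n * llog n)"
          using g_pos[of n] ll by (intro mult_right_mono) auto
        ultimately show "X (N (Suc k)) \<omega> \<ge> (1 - 4 * \<epsilon>) * (g (N (Suc k)) * llog (N (Suc k)))"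
          unfolding n_def by linarith
      qed
    qed
    from frequently_mp[OF this elim(1)]
    have "\<exists>\<^sub>F k in sequentially. X (N (Suc k)) \<omega> \<ge> (1 - 4 * \<epsilon>) * (g (N (Suc k)) * llog (N (Suc k)))" .
    then show ?case
      unfolding frequently_def using eventually_compose_filterlim[OF _ NS_top] by blast
  qed
qed

section \<open>From almost sure bounds to upper and lower limits\<close>

lemma (in lil_process) AE_limsup:
  assumes neg: "AE \<omega> in M. \<forall>\<^sub>F n in sequentially. - X n \<omega> \<le> 2 * (g n * llog n)"
  shows "AE \<omega> in M. limsup (\<lambda>n. ereal (X n \<omega> / (g n * llog n))) = 1"
proof -
  have "AE \<omega> in M. \<forall>k. \<forall>\<^sub>F n in sequentially. X n \<omega> \<le> (1 + 1 / real (Suc k)) * (g n * llog n)"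
    unfolding AE_all_countable by (intro allI AE_upper) simp
  \<comment> \<open>The denominator is \<open>k + 2\<close> rather than \<open>Suc k\<close> because
    the lower bound requires \<epsilon> < 1 already at \<open>k = 0\<close>.\<close>
  moreover have "AE \<omega> in M. \<forall>k. \<exists>\<^sub>F n in sequentially. X n \<omega> \<ge> (1 - 4 * (1 / real (k + 2))) * (g n * llog n)"
    unfolding AE_all_countable by (intro allI AE_lower neg) simp_all
  ultimately show ?thesis
  proof eventually_elim
    case (elim \<omega>)
    have pos: "\<forall>\<^sub>F n in sequentially. g n * llog n > 0"
      using llog_at_top[unfolded filterlim_at_top_dense, rule_format, of 0]
      by eventually_elim (simp add: g_pos)
    let ?f = "\<lambda>n. ereal (X n \<omega> / (g n * llog n))"
    have up: "limsup ?f \<le> ereal (1 + 1 / real (Suc k))" for k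
      by (rule Limsup_bounded, use elim(1)[rule_format, of k] pos in eventually_elim)
        (simp add: divide_le_eq)
    have lo: "ereal (1 - 4 * (1 / real (k + 2))) \<le> limsup ?f" for k
    proof (rule ccontr)
      assume "\<not> ereal (1 - 4 * (1 / real (k + 2))) \<le> limsup ?f"
      then have "\<forall>\<^sub>F n in sequentially. ?f n < ereal (1 - 4 * (1 / real (k + 2)))"
        by (intro Limsup_lessD) simp
      with pos have "\<forall>\<^sub>F n in sequentially. \<not> X n \<omega> \<ge> (1 - 4 * (1 / real (k + 2))) * (g n * llog n)"
        by eventually_elim (simp add: divide_less_eq not_le)
      then show False using elim(2)[rule_format, of k] by (simp add: frequently_def)
    qed
    have l1: "(\<lambda>k. ereal (1 + 1 / real (Suc k))) \<longlonglongrightarrow> ereal 1"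
      by (intro tendsto_ereal) real_asymp
    have l2: "(\<lambda>k. ereal (1 - 4 * (1 / real (k + 2)))) \<longlonglongrightarrow> ereal 1"
      by (intro tendsto_ereal) real_asymp
    have "limsup ?f \<le> ereal 1"
      by (rule tendsto_lowerbound[OF l1]) (use up in auto)
    moreover have "ereal 1 \<le> limsup ?f"
      by (rule tendsto_upperbound[OF l2]) (use lo in auto)
    ultimately show ?case by (simp add: one_ereal_def)
  qed
qed

theorem theorem2p2:
  fixes M :: "'s measure" and X :: "nat \<Rightarrow> 's \<Rightarrow> real"
    and L :: "real \<Rightarrow> real" and a :: real and g :: "nat \<Rightarrow> real"
  assumes "prob_space M"
    and meas: "\<And>n. X n \<in> borel_measurable M"
    and moments: "\<And>n (p::nat). integrable M (\<lambda>\<omega>. \<bar>X n \<omega>\<bar> ^ p)"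
    and X0: "\<And>\<omega>. \<omega> \<in> space M \<Longrightarrow> X 0 \<omega> = 0"
    and mean0: "\<And>n. n \<ge> 1 \<Longrightarrow> prob_space.expectation M (X n) = 0"
    \<comment> \<open>(A1)\<close>
    and L_sv: "slowly_varying L"
    and a_pos: "0 < a" and a_le: "a \<le> 1"
    and g_pos: "\<And>n. g n > 0"
    and g_asym: "(\<lambda>n. g n / (real n powr a * L (real n))) \<longlonglongrightarrow> 1"
    and A1: "\<exists>C>0. \<forall>n1 n2::nat. n1 < n2 \<longrightarrow>
        \<bar>prob_space.expectation M (\<lambda>\<omega>. ((X n2 \<omega> - X n1 \<omega>) / g (n2 - n1))^2) - 1\<bar>
          \<le> C / (1 + ln (real (n2 - n1)))"
    \<comment> \<open>(A2)\<close>
    and A2: "\<And>n p::nat. n \<ge> 1 \<Longrightarrow> p \<ge> 1 \<Longrightarrow>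
        limsup (\<lambda>k. ereal (prob_space.expectation M
                   (\<lambda>\<omega>. (X (k + n) \<omega> - X k \<omega>) ^ (2 * p)))) < \<infinity>"
    \<comment> \<open>(A3)\<close>
    and A3: "\<exists>C>0. \<exists>lam>0. \<forall>n1 n2::nat. n1 < n2 \<longrightarrow>
        (\<forall>\<theta>\<ge>1. wasserstein \<theta> (\<lambda>x y. \<bar>x - y\<bar>)
              (distr M borel (\<lambda>\<omega>. (X n2 \<omega> - X n1 \<omega>) / g (n2 - n1))) std_gaussian
            \<le> C * alpha_fun \<theta> * \<theta> powr lam / (1 + ln (real (n2 - n1))))
        \<and> kolmogorov_dist
              (distr M borel (\<lambda>\<omega>. (X n2 \<omega> - X n1 \<omega>) / g (n2 - n1))) std_gaussian
            \<le> C / (1 + ln (real (n2 - n1)))"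
    \<comment> \<open>(A4)\<close>
    and A4: "\<exists>q>1. \<forall>\<alpha>>0. \<exists>C. \<forall>d m::nat. d \<ge> 1 \<longrightarrow> m \<ge> 1 \<longrightarrow>
        (let n = (\<lambda>i::nat. nat \<lfloor>q powr (real (m + i) powr (1 + \<alpha>))\<rfloor>)
         in wasserstein 1 (eucl_dist d)
              (distr M (PiM {..<d} (\<lambda>_. borel))
                 (\<lambda>\<omega>. \<lambda>j\<in>{..<d}. (X (n (2*j+2)) \<omega> - X (n (2*j+1)) \<omega>)
                                   / g (n (2*j+2) - n (2*j+1))))
              (std_gaussian_vec d)
            \<le> real d * C / (1 + ln (real (n 2 - n 1))))"
  shows "AE \<omega> in M.
           limsup (\<lambda>n. ereal (X n \<omega> / sqrt (2 * (g n)^2 * ln (ln (real n))))) = 1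
         \<and> liminf (\<lambda>n. ereal (X n \<omega> / sqrt (2 * (g n)^2 * ln (ln (real n))))) = -1"
proof -
  interpret prob_space M by fact
  obtain C1 where A1': "C1 > 0" "\<And>n1 n2. n1 < n2 \<Longrightarrow>
      \<bar>expectation (\<lambda>\<omega>. ((X n2 \<omega> - X n1 \<omega>) / g (n2 - n1))\<^sup>2) - 1\<bar> \<le> C1 / (1 + ln (real (n2 - n1)))"
    using A1 by blast
  obtain C3 lam where C3: "C3 > 0" "lam > 0"
    and W: "\<And>n1 n2 \<theta>. n1 < n2 \<Longrightarrow> \<theta> \<ge> 1 \<Longrightarrow> wasserstein \<theta> (\<lambda>x y. \<bar>x - y\<bar>)
        (distr M borel (\<lambda>\<omega>. (X n2 \<omega> - X n1 \<omega>) / g (n2 - n1))) std_gaussian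
      \<le> C3 * alpha_fun \<theta> * \<theta> powr lam / (1 + ln (real (n2 - n1)))"
    using A3 by blast
  obtain q where q: "q > 1" and A4': "\<And>\<alpha>. \<alpha> > 0 \<Longrightarrow> \<exists>C. \<forall>d m::nat. d \<ge> 1 \<longrightarrow> m \<ge> 1 \<longrightarrow>
        (let n = (\<lambda>i::nat. nat \<lfloor>q powr (real (m + i) powr (1 + \<alpha>))\<rfloor>)
         in wasserstein 1 (eucl_dist d)
              (distr M (PiM {..<d} (\<lambda>_. borel))
                 (\<lambda>\<omega>. \<lambda>j\<in>{..<d}. (X (n (2*j+2)) \<omega> - X (n (2*j+1)) \<omega>)
                                   / g (n (2*j+2) - n (2*j+1))))
              (std_gaussian_vec d)
            \<le> real d * C / (1 + ln (real (n 2 - n 1))))"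
    using A4 by blast
  have diff_moments: "integrable M (\<lambda>\<omega>. \<bar>X n \<omega> - X m \<omega>\<bar> ^ p)" for m n p
  proof (rule Bochner_Integration.integrable_bound)
    show "integrable M (\<lambda>\<omega>. 2 ^ p * (\<bar>X n \<omega>\<bar> ^ p + \<bar>X m \<omega>\<bar> ^ p))" using moments by simp
    show "(\<lambda>\<omega>. \<bar>X n \<omega> - X m \<omega>\<bar> ^ p) \<in> borel_measurable M" using meas by measurable
    show "AE \<omega> in M. norm (\<bar>X n \<omega> - X m \<omega>\<bar> ^ p) \<le> norm (2 ^ p * (\<bar>X n \<omega>\<bar> ^ p + \<bar>X m \<omega>\<bar> ^ p))"
    proof (rule AE_I2)
      fix \<omega>
      show "norm (\<bar>X n \<omega> - X m \<omega>\<bar> ^ p) \<le> norm (2 ^ p * (\<bar>X n \<omega>\<bar> ^ p + \<bar>X m \<omega>\<bar> ^ p))"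
        using abs_add_power_le[of "X n \<omega>" "- X m \<omega>" p] by simp
    qed
  qed
  define Y where "Y m n \<omega> = (X n \<omega> - X m \<omega>) / g (n - m)" for m n \<omega>
  have Y_meas [measurable]: "Y m n \<in> borel_measurable M" for m n
    unfolding Y_def using meas by measurable
  have Y_int: "integrable M (\<lambda>\<omega>. \<bar>Y m n \<omega>\<bar> ^ p)" for m n p
    using diff_moments[of n m p] g_pos[of "n - m"] by (simp add: Y_def power_divide)
  \<comment> \<open>The numerator in (A3) at integer order; the convention
    \<open>alpha_fun 1 = 1\<close> keeps it positive at \<open>p = 1\<close>.\<close>
  define w where "w p = C3 * alpha_fun (real p) * real p powr lam" for p :: nat
  have w_pos: "w p > 0" if "p \<ge> 1" for p
    using that C3 by (auto simp: w_def alpha_fun_def)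
  have WY: "wasserstein (real p) (\<lambda>x y. \<bar>x - y\<bar>) (distr M borel (Y m n)) std_gaussian
      \<le> w p / (1 + ln (real (n - m)))" if "m < n" "p \<ge> 1" for m n p
    using W[OF that(1), of "real p"] that(2) by (simp add: w_def Y_def[abs_def])
  \<comment> \<open>\<open>k = 0\<close> relies on the default \<open>ln 0 = 0\<close>; it arises
    when two grid points of a block coincide.\<close>
  have ln0: "1 \<le> 1 + ln (real k)" for k :: nat by (cases "k = 0") auto
  \<comment> \<open>Selecting a coupling needs strict room above the Wasserstein bound; doubling
    supplies it because \<open>w p\<close> is positive.\<close>
  have w2: "w p / (1 + ln (real k)) < 2 * w p / (1 + ln (real k))" if "p \<ge> 1" for p k :: nat
    using w_pos[OF that] ln0[of k] by (intro divide_strict_right_mono) auto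

  have sd: "s * x - s * y = s * (x - y)" for s x y :: real by (simp add: algebra_simps)
  have blk: "\<exists>c>0. \<forall>\<alpha>>0. \<exists>C\<ge>0. \<forall>m t. m \<ge> 1 \<longrightarrow> t \<ge> 0 \<longrightarrow>
      (let N = (\<lambda>i::nat. nat \<lfloor>exp (c * real i powr (1 + \<alpha>))\<rfloor>)
       in prob {\<omega> \<in> space M. \<forall>j<m. s * X (N (m + 2 * j + 2)) \<omega> - s * X (N (m + 2 * j + 1)) \<omega>
                  \<le> t * g (N (m + 2 * j + 2) - N (m + 2 * j + 1))}
          \<le> (1 - exp (- (t + 2)\<^sup>2 / 2) / 3) ^ m
            + real m * C / (1 + ln (real (N (m + 2) - N (m + 1)))))" if s: "\<bar>s\<bar> = 1" for s :: real
  proof (rule exI[of _ "ln q"], intro conjI allI impI)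
    show "ln q > 0" using q by simp
    fix \<alpha> :: real assume \<alpha>: "\<alpha> > 0"
    define N where "N i = nat \<lfloor>exp (ln q * real i powr (1 + \<alpha>))\<rfloor>" for i
    have qN: "nat \<lfloor>q powr (real i powr (1 + \<alpha>))\<rfloor> = N i" for i
      using q by (simp add: N_def powr_def[of q] mult.commute)
    obtain C where C: "\<And>m::nat. m \<ge> 1 \<Longrightarrow> wasserstein 1 (eucl_dist m)
            (distr M (PiM {..<m} (\<lambda>_. borel))
               (\<lambda>\<omega>. \<lambda>j\<in>{..<m}. Y (N (m + (2 * j + 1))) (N (m + (2 * j + 2))) \<omega>))
            (std_gaussian_vec m)
          \<le> real m * C / (1 + ln (real (N (m + 2) - N (m + 1))))"
      using A4'[OF \<alpha>] unfolding Let_def qN Y_def by blast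
    show "\<exists>C\<ge>0. \<forall>m t. m \<ge> 1 \<longrightarrow> t \<ge> 0 \<longrightarrow>
      (let N = (\<lambda>i::nat. nat \<lfloor>exp (ln q * real i powr (1 + \<alpha>))\<rfloor>)
       in prob {\<omega> \<in> space M. \<forall>j<m. s * X (N (m + 2 * j + 2)) \<omega> - s * X (N (m + 2 * j + 1)) \<omega>
                  \<le> t * g (N (m + 2 * j + 2) - N (m + 2 * j + 1))}
          \<le> (1 - exp (- (t + 2)\<^sup>2 / 2) / 3) ^ m
            + real m * C / (1 + ln (real (N (m + 2) - N (m + 1)))))"
      unfolding Let_def N_def[symmetric]
    \<comment> \<open>The constant in (A4) may have any sign; this choice is nonnegative and
      strictly larger, as the coupling requires.\<close>
    proof (intro exI[of _ "\<bar>C\<bar> + 1"] conjI allI impI)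
      fix m :: nat and t :: real assume m: "m \<ge> 1" and t: "t \<ge> 0"
      have lt: "real m * C / (1 + ln (real (N (m + 2) - N (m + 1))))
          < real m * (\<bar>C\<bar> + 1) / (1 + ln (real (N (m + 2) - N (m + 1))))"
        using ln0[of "N (m + 2) - N (m + 1)"] m
        by (intro divide_strict_right_mono mult_strict_left_mono) auto
      have int: "integrable M (Y (N (m + (2 * j + 1))) (N (m + (2 * j + 2))))" for j
        by (rule integrable_abs_cancel[OF _ Y_meas])
          (use Y_int[of "N (m + (2 * j + 1))" "N (m + (2 * j + 2))" 1] in \<open>simp only: power_one_right\<close>)
      have "prob {\<omega> \<in> space M. \<forall>j<m. s * Y (N (m + (2 * j + 1))) (N (m + (2 * j + 2))) \<omega> \<le> t}
          \<le> (1 - exp (- (t + 2)\<^sup>2 / 2) / 3) ^ m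
            + real m * (\<bar>C\<bar> + 1) / (1 + ln (real (N (m + 2) - N (m + 1))))"
        by (rule wasserstein_gaussian_orthant[OF Y_meas int C[OF m] lt s t])
      also have "{\<omega> \<in> space M. \<forall>j<m. s * Y (N (m + (2 * j + 1))) (N (m + (2 * j + 2))) \<omega> \<le> t}
        = {\<omega> \<in> space M. \<forall>j<m. s * X (N (m + 2 * j + 2)) \<omega> - s * X (N (m + 2 * j + 1)) \<omega>
                  \<le> t * g (N (m + 2 * j + 2) - N (m + 2 * j + 1))}"
        using g_pos by (simp add: Y_def sd divide_le_eq add.assoc)
      finally show "prob {\<omega> \<in> space M. \<forall>j<m. s * X (N (m + 2 * j + 2)) \<omega> - s * X (N (m + 2 * j + 1)) \<omega>
                  \<le> t * g (N (m + 2 * j + 2) - N (m + 2 * j + 1))}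
          \<le> (1 - exp (- (t + 2)\<^sup>2 / 2) / 3) ^ m
            + real m * (\<bar>C\<bar> + 1) / (1 + ln (real (N (m + 2) - N (m + 1))))" .
    qed simp
  qed
  have lil: "lil_process M (\<lambda>n \<omega>. s * X n \<omega>) g (2 powr a)" if s: "\<bar>s\<bar> = 1" for s :: real
  proof
    have s2: "s\<^sup>2 = 1" using s by (metis one_power2 power2_abs)
    show "(\<lambda>\<omega>. s * X n \<omega>) \<in> borel_measurable M" for n using meas by measurable
    show "s * X 0 \<omega> = 0" if "\<omega> \<in> space M" for \<omega> using X0[OF that] by simp
    show "integrable M (\<lambda>\<omega>. (s * X n \<omega> - s * X m \<omega>)\<^sup>2)" for m n
      using diff_moments[of n m 2] by (simp add: sd power_mult_distrib s2)
    show "g n > 0" for n by (rule g_pos)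
    show "\<exists>C>0. \<forall>m n. m < n \<longrightarrow> \<bar>expectation (\<lambda>\<omega>. ((s * X n \<omega> - s * X m \<omega>) / g (n - m))\<^sup>2) - 1\<bar>
        \<le> C / (1 + ln (real (n - m)))"
      using A1' by (intro exI[of _ C1]) (simp add: sd power_mult_distrib power_divide s2)
    show "(\<lambda>i. g (2 ^ Suc i) / g (2 ^ i)) \<longlonglongrightarrow> 2 powr a"
      by (rule slowly_varying_double[OF L_sv g_pos g_asym])
    show "1 < 2 powr a" using a_pos by simp
    show "\<exists>K\<ge>0. \<forall>m n y. m < n \<longrightarrow> y > 0 \<longrightarrow>
        prob {\<omega> \<in> space M. \<bar>s * X n \<omega> - s * X m \<omega>\<bar> \<ge> y} \<le> K * (g (n - m) / y) ^ p" if p: "p \<ge> 1" for p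
    proof -
      define m0 where "m0 = enn2real (\<integral>\<^sup>+v. ennreal (\<bar>v\<bar> ^ p) \<partial>std_gaussian)"
      have "prob {\<omega> \<in> space M. \<bar>s * X n \<omega> - s * X m \<omega>\<bar> \<ge> y} \<le> 2 ^ p * ((2 * w p) ^ p + m0) * (g (n - m) / y) ^ p"
        if mn: "m < n" and y: "y > 0" for m n y
      proof -
        have "2 * w p / (1 + ln (real (n - m))) \<le> 2 * w p / 1"
          using w_pos[OF p] ln0[of "n - m"] by (intro divide_left_mono) auto
        then have "w p / (1 + ln (real (n - m))) < 2 * w p / 1" using w2[OF p, of "n - m"] by linarith
        then have "prob {\<omega> \<in> space M. \<bar>Y m n \<omega>\<bar> \<ge> y / g (n - m)}
            \<le> 2 ^ p * ((2 * w p / 1) ^ p + m0) / (y / g (n - m)) ^ p"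
          unfolding m0_def using g_pos[of "n - m"] y
          by (intro wasserstein_gaussian_moment_tail[OF Y_meas Y_int p WY[OF mn p]]) auto
        also have "\<dots> = 2 ^ p * ((2 * w p) ^ p + m0) * (g (n - m) / y) ^ p"
          by (simp add: power_divide)
        also have "{\<omega> \<in> space M. \<bar>Y m n \<omega>\<bar> \<ge> y / g (n - m)} = {\<omega> \<in> space M. \<bar>s * X n \<omega> - s * X m \<omega>\<bar> \<ge> y}"
          using g_pos[of "n - m"] s by (simp add: Y_def sd abs_mult divide_le_cancel)
        finally show ?thesis .
      qed
      moreover have "0 \<le> 2 ^ p * ((2 * w p) ^ p + m0)" using w_pos[OF p] by (simp add: m0_def)
      ultimately show ?thesis by blast
    qed
    show "\<exists>K\<ge>0. \<forall>m n x y. m < n \<longrightarrow> x \<ge> 0 \<longrightarrow> y > 0 \<longrightarrow>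
        prob {\<omega> \<in> space M. s * X n \<omega> - s * X m \<omega> > (x + y) * g (n - m)}
          \<le> exp (- x\<^sup>2 / 2) + K / (y * (1 + ln (real (n - m)))) ^ p" if p: "p \<ge> 1" for p
    proof -
      have "prob {\<omega> \<in> space M. s * X n \<omega> - s * X m \<omega> > (x + y) * g (n - m)}
          \<le> exp (- x\<^sup>2 / 2) + (2 * w p) ^ p / (y * (1 + ln (real (n - m)))) ^ p"
        if mn: "m < n" and x: "x \<ge> 0" and y: "y > 0" for m n x y
      proof -
        have "prob {\<omega> \<in> space M. s * Y m n \<omega> > x + y}
            \<le> exp (- x\<^sup>2 / 2) + (2 * w p / (1 + ln (real (n - m))) / y) ^ p"
          by (rule wasserstein_gaussian_tail[OF Y_meas Y_int p WY[OF mn p] w2[OF p] s x y])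
        also have "(2 * w p / (1 + ln (real (n - m))) / y) ^ p = (2 * w p) ^ p / (y * (1 + ln (real (n - m)))) ^ p"
          by (simp add: power_divide mult.commute)
        also have "{\<omega> \<in> space M. s * Y m n \<omega> > x + y}
            = {\<omega> \<in> space M. s * X n \<omega> - s * X m \<omega> > (x + y) * g (n - m)}"
          using g_pos[of "n - m"] by (simp add: Y_def sd less_divide_eq)
        finally show ?thesis .
      qed
      moreover have "0 \<le> (2 * w p) ^ p" using w_pos[OF p] by simp
      ultimately show ?thesis by blast
    qed
  qed (rule blk[OF s])

  have norm_eq: "sqrt (2 * (g n)\<^sup>2 * ln (ln (real n))) = g n * llog n" for n
    using g_pos[of n] by (simp add: llog_def real_sqrt_mult)
  have up: "AE \<omega> in M. \<forall>\<^sub>F n in sequentially. s * X n \<omega> \<le> 2 * (g n * llog n)" if "\<bar>s\<bar> = 1" for s :: real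
    using lil_process.AE_upper[OF lil[OF that], of 1] by simp
  \<comment> \<open>The a priori bound needed for the sign \<open>s\<close> is the upper bound for
    \<open>- s\<close>. Taking \<open>s = 1\<close> and \<open>s = - 1\<close> gives the upper and,
    after negation, the lower limit.\<close>
  have limsup: "AE \<omega> in M. limsup (\<lambda>n. ereal (s * X n \<omega> / (g n * llog n))) = 1" if "\<bar>s\<bar> = 1" for s :: real
    using lil_process.AE_limsup[OF lil[OF that]] up[of "- s"] that by simp
  have sup1: "AE \<omega> in M. limsup (\<lambda>n. ereal (X n \<omega> / (g n * llog n))) = 1"
    using limsup[of 1] by simp
  have sup2: "AE \<omega> in M. limsup (\<lambda>n. - ereal (X n \<omega> / (g n * llog n))) = 1"
    using limsup[of "- 1"] by simp
  show ?thesis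
    unfolding norm_eq using sup1 sup2
  proof eventually_elim
    case (elim \<omega>)
    have "- liminf (\<lambda>n. ereal (X n \<omega> / (g n * llog n))) = 1"
      using elim(2) unfolding ereal_Limsup_uminus .
    then have "liminf (\<lambda>n. ereal (X n \<omega> / (g n * llog n))) = - 1"
      by (metis ereal_uminus_uminus)
    then show ?case using elim(1) by simp
  qed
qed

end
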